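(* For each fixed integer $d\ge2$, put $q_a=e^{-2\pi/\sqrt a}$ and $Q=q_a^a=e^{-2\pi\sqrt a}$. As the integer $a$ tends to infinity, $$W_{a,d}(q_a,24)-a^6=24q_a(q_a-1)(-23)^{d-2}Q^{2d-2}+O_d(a^6Q^{2d-1}).$$ Consequently, $$W_{a,d}(q_a,24)-a^6\sim48\pi(-1)^{d-1}23^{d-2}a^{-1/2}e^{-4\pi(d-1)\sqrt a}.$$
   Context: $\Phi(q)=\prod_{n\ge1}(1-q^n)$. For integers $a,d\ge2$ and $0<|q|<1$, $$W_{a,d}(q,24)=\frac1d\sum_{z^d=1}\frac{\sum_{m\ge0}z^mq^{am+1}\Phi(q^{am+1})^{24}}{\sum_{m\ge0}z^mq^{a(m+1)}\Phi(q^{a(m+1)})^{24}}.$$ *)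

theory Defs
  imports "HOL-Analysis.Analysis" "HOL-Library.Landau_Symbols"
begin

(* The index n starts at 0 here, so the factor 1 - q^n of the product over n \<ge> 1
   appears as 1 - q^(Suc n). *)
definition Phi :: "complex \<Rightarrow> complex" where
  "Phi q = (\<Prod>n. 1 - q ^ Suc n)"

(* W24 a d q is W_{a,d}(q,24), meaningful for a, d \<ge> 2 and 0 < |q| < 1. *)
definition W24 :: "nat \<Rightarrow> nat \<Rightarrow> complex \<Rightarrow> complex" where
  "W24 a d q =
     1 / of_nat d *
     (\<Sum>z | z ^ d = 1.
        (\<Sum>m. z ^ m * q ^ (a * m + 1) * Phi (q ^ (a * m + 1)) ^ 24) /
        (\<Sum>m. z ^ m * q ^ (a * (m + 1)) * Phi (q ^ (a * (m + 1))) ^ 24))"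

definition nome :: "nat \<Rightarrow> real" where
  "nome a = exp (- 2 * pi / sqrt (real a))"

definition Nome :: "nat \<Rightarrow> real" where
  "Nome a = nome a ^ a"

lemma Nome_eq: "Nome a = exp (- 2 * pi * sqrt (real a))"
proof -
  have "real a * (- 2 * pi / sqrt (real a)) = - 2 * pi * sqrt (real a)"
    by (cases "a = 0") (simp_all add: field_simps)
  then show ?thesis
    unfolding Nome_def nome_def by (simp only: exp_of_nat_mult [symmetric])
qed

end

theory Submission
  imports Defs "HOL-Computational_Algebra.Formal_Power_Series" "HOL-Real_Asymp.Real_Asymp"
begin

text \<open>
  Write \<open>N z\<close> and \<open>D z\<close> for the numerator and denominator series. At \<open>q = nome a\<close> the modular
  inversion of \<open>q \<Phi>(q)^24\<close> says that their constant coefficients have ratio \<open>a^6\<close>, so that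
  \<open>N / D - a^6\<close> is a power series in \<open>z\<close> without constant term, and averaging over the \<open>d\<close>-th roots
  of unity keeps its coefficients of index divisible by \<open>d\<close>. In the variable \<open>u = z Q\<^sup>2\<close>, and after
  clearing the pole at \<open>z = 1 / Q\<close>, both series have bounded coefficients. Up to \<open>O(a^6 Q)\<close> the
  coefficients of \<open>Q\<^sup>2 (N / D - a^6)\<close> are those of \<open>(q u + (24 q\<^sup>2 - q) u\<^sup>2) / (1 + 23 u)\<close>,
  and the one of \<open>u^d\<close> gives the main term.

  For the inversion, expand \<open>ln \<Phi>(e^(-2 \<pi> y)) = - (\<Sum>m. 1 / (m (e^(2 \<pi> m y) - 1)))\<close> by the partial
  fractions of coth. This gives a double series with terms \<open>y / (m\<^sup>2 y\<^sup>2 + n\<^sup>2)\<close>, symmetric under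
  \<open>y \<mapsto> 1 / y\<close> except for the order of summation, which accounts for the term \<open>ln y / 2\<close>.
\<close>

section \<open>Partial fractions and the logarithm of the Euler product\<close>

text \<open>Differentiate \<open>rGamma z * rGamma (1 - z) = sin (pi * z) / pi\<close> and divide by
  its value. The reciprocal Gamma function is entire, and off the integers the sine is
  nonzero.\<close>

lemma Digamma_reflection:
  fixes z :: complex
  assumes "z \<notin> \<int>"
  shows "Digamma (1 - z) - Digamma z = pi * cot (pi * z)"
proof -
  have z: "z \<notin> \<int>\<^sub>\<le>\<^sub>0" "1 - z \<notin> \<int>\<^sub>\<le>\<^sub>0"
    using assms by (auto elim!: nonpos_Ints_cases) (metis Ints_1 Ints_diff Ints_of_int diff_diff_eq2 diff_add_cancel add_diff_cancel_left')+
  have sin: "sin (pi * z) \<noteq> 0"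
    using assms by (auto simp: sin_eq_0)
  have "((\<lambda>z. rGamma z * rGamma (1 - z)) has_field_derivative
          rGamma z * rGamma (1 - z) * (Digamma (1 - z) - Digamma z)) (at z)"
    using z by (auto intro!: derivative_eq_intros simp: algebra_simps)
  moreover have "((\<lambda>z. rGamma z * rGamma (1 - z)) has_field_derivative cos (pi * z)) (at z)"
    unfolding rGamma_reflection_complex by (auto intro!: derivative_eq_intros)
  ultimately have "rGamma z * rGamma (1 - z) * (Digamma (1 - z) - Digamma z) = cos (pi * z)"
    by (rule DERIV_unique)
  then show ?thesis
    using sin by (simp add: rGamma_reflection_complex cot_def field_simps)
qed

lemma Digamma_sums:
  fixes z :: complex
  assumes "z \<noteq> 0"
  shows "(\<lambda>n. inverse (of_nat (Suc n)) - inverse (z + of_nat n)) sums (Digamma z + euler_mascheroni)"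
  using summable_sums[OF summable_Digamma[OF assms]] by (simp add: Digamma_def)

text \<open>At \<open>z = i x\<close>, subtract the Digamma series at \<open>1 + z\<close> from the
  one at \<open>1 - z\<close>: the terms combine to \<open>-2 z / (x^2 + (n + 1)^2)\<close>, and
  reflection with the recurrence \<open>Digamma (1 + z) = Digamma z + 1 / z\<close> evaluates the
  sum. The value is \<open>(pi coth (pi x) - 1 / x) / (2 x)\<close>, with coth written through
  \<open>1 / (e^(2 pi x) - 1)\<close> to match the Lambert series of the Euler product.\<close>

lemma coth_partial_fractions:
  fixes x :: real
  assumes "x > 0"
  shows "(\<lambda>n. 1 / (x\<^sup>2 + (real (Suc n))\<^sup>2)) sums
           ((pi + 2 * pi / (exp (2 * pi * x) - 1) - 1 / x) / (2 * x))"
proof -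
  define z :: complex where "z = \<i> * x"
  have Im: "Im z = x" "Re z = 0" by (auto simp: z_def)
  have z: "z \<notin> \<int>" "z \<noteq> 0" "1 + z \<noteq> 0" "1 - z \<noteq> 0"
    using assms Im by (auto simp: complex_eq_iff elim!: Ints_cases)
  have nz: "1 + z + of_nat n \<noteq> 0" "1 - z + of_nat n \<noteq> 0" for n
    using assms Im by (auto simp: complex_eq_iff)
  have "(\<lambda>n. (inverse (of_nat (Suc n)) - inverse (1 - z + of_nat n))
           - (inverse (of_nat (Suc n)) - inverse (1 + z + of_nat n)))
         sums ((Digamma (1 - z) + euler_mascheroni) - (Digamma (1 + z) + euler_mascheroni))"
    using z by (intro sums_diff Digamma_sums) auto
  also have "(Digamma (1 - z) + euler_mascheroni) - (Digamma (1 + z) + euler_mascheroni)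
      = pi * cot (pi * z) - 1 / z"
    using Digamma_reflection[OF z(1)] Digamma_plus1[OF z(2)] by (simp add: algebra_simps)
  also have "(\<lambda>n. (inverse (of_nat (Suc n)) - inverse (1 - z + of_nat n))
           - (inverse (of_nat (Suc n)) - inverse (1 + z + of_nat n)))
     = (\<lambda>n. (- 2 * z) * of_real (1 / (x\<^sup>2 + (real (Suc n))\<^sup>2)))"
  proof
    fix n
    have "(1 + z + of_nat n) * (1 - z + of_nat n) = of_real (x\<^sup>2 + (real (Suc n))\<^sup>2)"
      by (simp add: z_def algebra_simps power2_eq_square)
    then show "(inverse (of_nat (Suc n)) - inverse (1 - z + of_nat n))
           - (inverse (of_nat (Suc n)) - inverse (1 + z + of_nat n))
       = (- 2 * z) * of_real (1 / (x\<^sup>2 + (real (Suc n))\<^sup>2))"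
      using nz[of n] by (simp add: field_simps)
  qed
  finally have "(\<lambda>n. of_real (1 / (x\<^sup>2 + (real (Suc n))\<^sup>2))) sums ((pi * cot (pi * z) - 1 / z) / (- 2 * z))"
    using z(2) by (intro sums_mult_D) auto
  also have "(pi * cot (pi * z) - 1 / z) / (- 2 * z)
      = of_real ((pi + 2 * pi / (exp (2 * pi * x) - 1) - 1 / x) / (2 * x))"
  proof -
    define E where "E = exp (pi * x)"
    have E: "E > 1" using assms by (simp add: E_def)
    have E2: "exp (2 * pi * x) = E\<^sup>2" by (simp add: E_def exp_double[symmetric] mult.assoc)
    have "E * E > 1 * 1" using E by (intro mult_strict_mono) auto
    then have EE: "E * E - 1 \<noteq> 0" "E * E \<noteq> 1" by auto
    have *: "exp (\<i> * (pi * z)) = of_real (1 / E)" "exp (- (\<i> * (pi * z))) = of_real E"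
      by (simp_all add: z_def E_def exp_minus field_simps flip: exp_of_real)
    \<comment> \<open>On the imaginary axis the cotangent is \<open>- i coth (pi x)\<close>, and
      \<open>(E + 1/E) / (E - 1/E) = 1 + 2 / (E^2 - 1)\<close>.\<close>
    have "pi * cot (pi * z) = - \<i> * of_real (pi * ((E + 1 / E) / (E - 1 / E)))"
    proof -
      have "sin (pi * z) = of_real (1 / E - E) / (2 * \<i>)" "cos (pi * z) = of_real (1 / E + E) / 2"
        by (simp_all only: sin_exp_eq cos_exp_eq * of_real_add of_real_diff)
      moreover have "1 / E - E \<noteq> 0"
        using E EE by (simp add: field_simps)
      then have "complex_of_real (1 / E - E) \<noteq> 0"
        by (simp only: of_real_eq_0_iff not_False_eq_True)
      moreover have "(a / 2) / (b / (2 * \<i>)) = \<i> * (a / b)" if "b \<noteq> 0" for a b :: complex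
        using that by (simp add: divide_simps)
      ultimately have "cot (pi * z) = \<i> * (of_real (1 / E + E) / of_real (1 / E - E))"
        by (simp only: cot_def not_False_eq_True)
      also have "\<dots> = - \<i> * of_real ((E + 1 / E) / (E - 1 / E))"
      proof -
        have "(E + 1 / E) / (E - 1 / E) = - ((1 / E + E) / (1 / E - E))"
          by (metis add.commute minus_diff_eq minus_divide_right)
        then show ?thesis
          by (simp only: of_real_divide of_real_minus mult_minus_left mult_minus_right minus_minus)
      qed
      finally show ?thesis by simp
    qed
    also have "pi * ((E + 1 / E) / (E - 1 / E)) = pi + 2 * pi / (E\<^sup>2 - 1)"
      using E EE by (simp add: field_simps power2_eq_square)
    finally have "pi * cot (pi * z) = - \<i> * of_real (pi + 2 * pi / (E\<^sup>2 - 1))" .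
    moreover have "(- \<i> * of_real K - 1 / z) / (- 2 * z) = of_real ((K - 1 / x) / (2 * x))" for K :: real
      using assms by (simp add: z_def field_simps)
    ultimately show ?thesis
      unfolding E2 by (simp only:)
  qed
  finally show ?thesis
    by (simp only: sums_of_real_iff)
qed

section \<open>The Euler product at real arguments and its logarithm\<close>

definition euler_phi :: "real \<Rightarrow> real" where
  "euler_phi x = (\<Prod>n. 1 - x ^ Suc n)"

lemma summable_power_Suc: "0 \<le> x \<Longrightarrow> x < 1 \<Longrightarrow> summable (\<lambda>n. x ^ Suc n)" for x :: real
  by (subst summable_Suc_iff) (simp add: summable_geometric)

lemma convergent_prod_euler_phi:
  fixes x :: real
  assumes "0 \<le> x" "x < 1"
  shows "convergent_prod (\<lambda>n. 1 - x ^ Suc n)"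
  using summable_power_Suc[OF assms] assms
  by (intro abs_convergent_prod_imp_convergent_prod)
     (simp add: abs_convergent_prod_conv_summable)

lemma has_prod_euler_phi:
  fixes x :: real
  assumes "0 \<le> x" "x < 1"
  shows "(\<lambda>n. 1 - x ^ Suc n) has_prod euler_phi x"
  using convergent_prod_has_prod[OF convergent_prod_euler_phi[OF assms]] by (simp add: euler_phi_def)

lemma Phi_of_real:
  fixes x :: real
  assumes "0 \<le> x" "x < 1"
  shows "Phi (of_real x) = of_real (euler_phi x)"
proof -
  have "(\<lambda>n. of_real (1 - x ^ Suc n)) has_prod complex_of_real (euler_phi x)"
    using has_prod_euler_phi[OF assms] by (subst has_prod_of_real_iff)
  then show ?thesis
    unfolding Phi_def by (simp add: has_prod_iff)
qed

text \<open>Expand each \<open>- ln (1 - x^n)\<close> as the sum over m of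
  \<open>x^(n m) / m\<close> and sum over n first, which leaves geometric series. All terms are
  nonnegative, so the exchange is legitimate.\<close>

lemma ln_euler_phi_sums:
  fixes x :: real
  assumes "0 < x" "x < 1"
  shows "(\<lambda>m. - (x ^ Suc m / (real (Suc m) * (1 - x ^ Suc m)))) sums ln (euler_phi x)"
proof -
  have pow: "0 < x ^ Suc n" "x ^ Suc n < 1" for n
    using assms by (auto simp: power_Suc_less_one simp del: power_Suc)
  define f where "f = (\<lambda>(n, m). x ^ (Suc n * Suc m) / real (Suc m))"
  have row: "((\<lambda>m. f (n, m)) has_sum - ln (1 - x ^ Suc n)) UNIV" for n
  proof (rule sums_nonneg_imp_has_sum)
    have "(\<lambda>m. - ((x ^ Suc n) ^ m) / real m) sums ln (1 - x ^ Suc n)"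
      using ln_series'[of "- (x ^ Suc n)"] pow[of n] by (simp del: power_Suc)
    then have "(\<lambda>m. - ((x ^ Suc n) ^ Suc m) / real (Suc m)) sums ln (1 - x ^ Suc n)"
      by (subst sums_Suc_iff) simp
    from sums_minus[OF this] show "(\<lambda>m. f (n, m)) sums - ln (1 - x ^ Suc n)"
      by (simp add: f_def power_mult[symmetric] del: power_Suc)
  qed (use assms in \<open>auto simp: f_def\<close>)
  have col: "((\<lambda>n. f (n, m)) has_sum (x ^ Suc m / (real (Suc m) * (1 - x ^ Suc m)))) UNIV" for m
  proof (rule sums_nonneg_imp_has_sum)
    have "(\<lambda>n. (x ^ Suc m) ^ n) sums (1 / (1 - x ^ Suc m))"
      using pow[of m] by (intro geometric_sums) auto
    from sums_mult[OF this, of "x ^ Suc m / real (Suc m)"]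
    show "(\<lambda>n. f (n, m)) sums (x ^ Suc m / (real (Suc m) * (1 - x ^ Suc m)))"
      by (simp add: f_def power_mult[symmetric] power_add[symmetric] mult_ac add_ac del: power_Suc)
  qed (use assms in \<open>auto simp: f_def\<close>)
  have "(\<lambda>n. ln (1 - x ^ Suc n)) sums ln (euler_phi x)"
    using has_prod_imp_sums_ln_real'[OF has_prod_euler_phi] assms pow by (simp del: power_Suc)
  then have rows: "((\<lambda>n. - ln (1 - x ^ Suc n)) has_sum - ln (euler_phi x)) UNIV"
    using pow less_imp_le[OF pow(1)] by (intro sums_nonneg_imp_has_sum sums_minus) (auto simp del: power_Suc)
  have "f summable_on UNIV \<times> UNIV"
    using row rows assms by (intro summable_on_SigmaI) (auto simp: f_def has_sum_imp_summable)
  then obtain S where S: "(f has_sum S) (UNIV \<times> UNIV)"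
    by (auto simp: summable_on_def)
  have "((\<lambda>n. - ln (1 - x ^ Suc n)) has_sum S) UNIV"
    by (rule has_sum_SigmaD[OF S]) (rule row)
  with rows have S_eq: "S = - ln (euler_phi x)"
    using has_sum_unique by blast
  have "((\<lambda>(m, n). f (n, m)) has_sum S) (UNIV \<times> UNIV)"
    using S by (subst has_sum_swap) simp
  then have "((\<lambda>m. x ^ Suc m / (real (Suc m) * (1 - x ^ Suc m))) has_sum S) UNIV"
    by (rule has_sum_SigmaD) (simp only: prod.case, rule col)
  then have "(\<lambda>m. x ^ Suc m / (real (Suc m) * (1 - x ^ Suc m))) sums S"
    by (rule has_sum_imp_sums)
  from sums_minus[OF this] show ?thesis by (simp add: S_eq)
qed

section \<open>Inversion of the discriminant on the imaginary axis\<close>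

lemma exists_arctan_quotient_antiderivative:
  "\<exists>A::real \<Rightarrow> real. A 0 = 0 \<and> (\<forall>t\<ge>0.
     (A has_real_derivative (if t = 0 then 1 else arctan t / t)) (at t within {0..}))"
proof -
  define h :: "real \<Rightarrow> real" where "h t = (if t = 0 then 1 else arctan t / t)" for t
  define A where "A t = integral {0..t} h" for t
  have "((\<lambda>t::real. arctan t / t) \<longlongrightarrow> 1) (at 0)"
    using DERIV_arctan[of 0] by (simp add: has_field_derivative_iff)
  then have "(h \<longlongrightarrow> h 0) (at 0)"
    by (rule Lim_transform_eventually[THEN tendsto_eq_rhs]) (auto simp: h_def eventually_at intro: exI[of _ 1])
  then have "isCont h 0" by (simp add: isCont_def)
  moreover have "isCont h t" if "t \<noteq> 0" for t
  proof -
    have "isCont (\<lambda>t. arctan t / t) t" using that by (intro continuous_intros)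
    moreover have "eventually (\<lambda>t. h t = arctan t / t) (nhds t)"
      using t1_space_nhds[OF that] by (rule eventually_mono) (auto simp: h_def)
    ultimately show ?thesis by (subst isCont_cong)
  qed
  ultimately have cont: "continuous_on S h" for S
    by (metis continuous_at_imp_continuous_on)
  have "(A has_real_derivative h t) (at t within {0..})" if "t \<ge> 0" for t
  proof -
    have "(A has_real_derivative h t) (at t within {0..t+1})"
      unfolding A_def using that cont by (intro integral_has_real_derivative) auto
    moreover have "at t within {0..t+1} = at t within {0..}"
      by (rule at_within_nhd[of t "{..<t+1}"]) auto
    ultimately show ?thesis by simp
  qed
  then show ?thesis
    unfolding h_def by (intro exI[of _ A]) (simp add: A_def)
qed

text \<open>The derivative has the sign of \<open>x / (1 + x^2) - arctan x\<close>. This vanishes at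
  0 and decreases, its derivative being \<open>-2 x^2 / (1 + x^2)^2\<close>.\<close>

lemma arctan_quotient_antimono:
  fixes s t :: real
  assumes "0 < s" "s \<le> t"
  shows "arctan t / t \<le> arctan s / s"
proof (rule DERIV_nonpos_imp_nonincreasing[OF assms(2), where f = "\<lambda>t. arctan t / t"])
  fix x assume x: "s \<le> x" "x \<le> t"
  then have x0: "x > 0" using assms by simp
  have "(\<lambda>x. arctan x - x / (1 + x\<^sup>2)) 0 \<le> arctan x - x / (1 + x\<^sup>2)"
  proof (rule DERIV_nonneg_imp_nondecreasing[where f = "\<lambda>x. arctan x - x / (1 + x\<^sup>2)"])
    fix u :: real assume "0 \<le> u"
    have nz: "1 + u\<^sup>2 \<noteq> 0" by (smt (verit) zero_le_power2)
    have "((\<lambda>x. arctan x - x / (1 + x\<^sup>2)) has_real_derivative 2 * u\<^sup>2 / (1 + u\<^sup>2)\<^sup>2) (at u)"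
      by (rule derivative_eq_intros refl nz)+ (use nz in \<open>simp add: divide_simps, simp add: algebra_simps power2_eq_square\<close>)
    then show "\<exists>y. ((\<lambda>x. arctan x - x / (1 + x\<^sup>2)) has_real_derivative y) (at u) \<and> 0 \<le> y"
      by (auto intro!: exI)
  qed (use x0 in auto)
  then have "x / (1 + x\<^sup>2) \<le> arctan x" by simp
  moreover have "((\<lambda>x. arctan x / x) has_real_derivative (x / (1 + x\<^sup>2) - arctan x) / x\<^sup>2) (at x)"
    using x0 by (auto intro!: derivative_eq_intros simp: field_simps power2_eq_square)
  ultimately show "\<exists>y. ((\<lambda>x. arctan x / x) has_real_derivative y) (at x) \<and> y \<le> 0"
    by (intro exI conjI) (auto intro!: divide_nonpos_nonneg)
qed

text \<open>Each sum is a right Riemann sum of \<open>arctan t / t\<close>, over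
  \<open>[0, y]\<close> and over \<open>[0, 1/y]\<close>, and so converges to the antiderivative
  \<open>A\<close>. The identity \<open>arctan t + arctan (1 / t) = pi / 2\<close> then gives
  \<open>A y - A (1 / y)\<close>.\<close>

lemma arctan_sum_diff_tendsto:
  fixes y :: real
  assumes "y > 0"
  shows "(\<lambda>N. (\<Sum>m<N. arctan (real (Suc m) * y / real N) / real (Suc m))
            - (\<Sum>m<N. arctan (real (Suc m) / y / real N) / real (Suc m))) \<longlonglongrightarrow> pi / 2 * ln y"
proof -
  define h :: "real \<Rightarrow> real" where "h t = (if t = 0 then 1 else arctan t / t)" for t
  have h: "h 0 = 1" "\<And>t. t \<noteq> 0 \<Longrightarrow> h t = arctan t / t"
    by (simp_all add: h_def)
  obtain A where A: "A 0 = 0 \<and> (\<forall>t\<ge>0. (A has_real_derivative h t) (at t within {0..}))"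
    using exists_arctan_quotient_antiderivative unfolding h_def by (rule exE)
  then have A0: "A 0 = 0" by blast
  have deriv: "(A has_real_derivative h t) (at t within {0..})" if "t \<ge> 0" for t
    using A that by blast
  have deriv': "(A has_real_derivative h t) (at t)" if "t > 0" for t
  proof -
    have "(A has_real_derivative h t) (at t within {0<..})"
      using that by (intro DERIV_subset[OF deriv]) auto
    moreover have "at t within {0<..} = at t"
      using that by (intro at_within_open) auto
    ultimately show ?thesis by (simp only:)
  qed
  have contA: "continuous_on {s..t} A" if "s \<ge> 0" for s t
  proof (rule continuous_on_subset)
    show "continuous_on {0..} A"
      by (rule DERIV_continuous_on, rule deriv) simp
  qed (use that in auto)
  have h_le1: "h t \<le> 1" if "t \<ge> 0" for t
    using that arctan_le_self[of t] by (simp add: h_def divide_le_eq)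
  have h_nonneg: "h t \<ge> 0" if "t \<ge> 0" for t
    using that by (simp add: h_def)
  have anti: "h t \<le> h s" if "0 \<le> s" "s \<le> t" for s t
    using arctan_quotient_antimono[of s t] that h_le1[of t] by (auto simp: h_def)
  have step: "(t - s) * h t \<le> A t - A s" "A t - A s \<le> (t - s) * h s" if st: "0 \<le> s" "s < t" for s t
  proof -
    obtain l u where u: "s < u" "u < t" "DERIV A u :> l" "A t - A s = (t - s) * l"
    proof -
      have "A differentiable (at x)" if "s < x" for x
        using deriv'[of x] st that by (auto simp: real_differentiable_def)
      then show ?thesis using MVT[OF st(2) contA[OF st(1)]] that by blast
    qed
    have "u > 0" using u st by simp
    then have "l = h u" using deriv'[of u] u(3) by (blast intro: DERIV_unique)
    with u st show "(t - s) * h t \<le> A t - A s" "A t - A s \<le> (t - s) * h s"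
      using anti[of u t] anti[of s u] by (auto intro!: mult_left_mono)
  qed
  have lim: "(\<lambda>N. \<Sum>m<N. arctan (real (Suc m) * c / real N) / real (Suc m)) \<longlonglongrightarrow> A c" if c: "c > 0" for c
  proof (rule tendsto_sandwich)
    have bounds: "A c - c / real N \<le> (\<Sum>m<N. arctan (real (Suc m) * c / real N) / real (Suc m)) \<and>
        (\<Sum>m<N. arctan (real (Suc m) * c / real N) / real (Suc m)) \<le> A c" if N: "N > 0" for N
    proof -
      define s where "s = c / real N"
      have s: "s > 0" "real N * s = c" using N c by (auto simp: s_def)
      have L: "(\<Sum>m<N. arctan (real (Suc m) * c / real N) / real (Suc m)) = (\<Sum>m<N. s * h (real (Suc m) * s))"
      proof (rule sum.cong)
        fix m
        have "real (Suc m) * s \<noteq> 0" using s by simp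
        then have "s * h (real (Suc m) * s) = arctan (real (Suc m) * s) / real (Suc m)"
          using s by (simp add: h_def)
        then show "arctan (real (Suc m) * c / real N) / real (Suc m) = s * h (real (Suc m) * s)"
          by (simp add: s_def)
      qed simp
      have tele: "(\<Sum>m<N. A (real (Suc m) * s) - A (real m * s)) = A c"
        using sum_lessThan_telescope[of "\<lambda>m. A (real m * s)" N] s A0 by simp
      define S1 where "S1 = (\<Sum>m<N. s * h (real (Suc m) * s))"
      define S0 where "S0 = (\<Sum>m<N. s * h (real m * s))"
      have "S1 \<le> A c"
        unfolding S1_def tele[symmetric] using s step(1)[of "real m * s" "real (Suc m) * s" for m]
        by (intro sum_mono) (simp add: algebra_simps)
      moreover have "A c \<le> S0"
        unfolding S0_def tele[symmetric] using s step(2)[of "real m * s" "real (Suc m) * s" for m]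
        by (intro sum_mono) (simp add: algebra_simps)
      \<comment> \<open>Left and right Riemann sums differ only in their end terms. With
        \<open>h\<close> between 0 and 1 the gap is at most one mesh width \<open>s\<close>, and by
        monotonicity \<open>A c\<close> lies between the two sums.\<close>
      moreover have "S1 - S0 = s * h (real N * s) - s * h 0"
        using sum_lessThan_telescope[of "\<lambda>m. s * h (real m * s)" N]
        by (simp add: S1_def S0_def sum_subtractf)
      moreover have "s * h (real N * s) \<ge> 0" "s * h 0 = s"
        using s c h_nonneg[of "real N * s"] h(1) by simp_all
      ultimately have "A c - s \<le> S1 \<and> S1 \<le> A c" by linarith
      then show ?thesis by (simp only: L S1_def s_def)
    qed
    show "\<forall>\<^sub>F N in sequentially. A c - c / real N \<le> (\<Sum>m<N. arctan (real (Suc m) * c / real N) / real (Suc m))"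
      using eventually_gt_at_top[of 0] by eventually_elim (use bounds in blast)
    show "\<forall>\<^sub>F N in sequentially. (\<Sum>m<N. arctan (real (Suc m) * c / real N) / real (Suc m)) \<le> A c"
      using eventually_gt_at_top[of 0] by eventually_elim (use bounds in blast)
    show "(\<lambda>N. A c - c / real N) \<longlonglongrightarrow> A c"
      by real_asymp
  qed auto
  \<comment> \<open>\<open>D\<close> is constant on the positive axis: its derivative is
    \<open>(arctan t + arctan (1 / t) - pi / 2) / t = 0\<close>. Moreover
    \<open>D 1 = 0\<close>.\<close>
  define D where "D t = A t - A (1 / t) - pi / 2 * ln t" for t
  have "D y = D 1"
  proof -
    have "(D has_real_derivative 0) (at t within {0<..})" if "t \<in> {0<..}" for t
    proof -
      have t: "t > 0" using that by simp
      have "(D has_real_derivative h t + h (1 / t) / t\<^sup>2 - pi / 2 / t) (at t within {0<..})"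
        unfolding D_def using t
        by (auto intro!: derivative_eq_intros DERIV_chain2[OF deriv'] DERIV_subset[OF deriv'] simp: power2_eq_square)
      moreover have "h t + h (1 / t) / t\<^sup>2 - pi / 2 / t = 0"
        using t arctan_inverse[of t] by (simp add: h field_simps power2_eq_square)
      ultimately show ?thesis by simp
    qed
    then obtain c where "\<forall>t\<in>{0<..}. D t = c"
      using has_field_derivative_zero_constant[of "{0<..}" D] by auto
    then show ?thesis
      using assms by simp
  qed
  then have "A y - A (1 / y) = pi / 2 * ln y" by (simp add: D_def)
  moreover have "(\<lambda>N. (\<Sum>m<N. arctan (real (Suc m) * y / real N) / real (Suc m))
            - (\<Sum>m<N. arctan (real (Suc m) * (1 / y) / real N) / real (Suc m))) \<longlonglongrightarrow> A y - A (1 / y)"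
    using assms by (intro tendsto_diff lim) auto
  ultimately show ?thesis by (simp only: times_divide_eq_right mult_1_right)
qed

section \<open>Row tails compared with arctangents\<close>

lemma arctan_difference_bounds:
  fixes c t :: real
  assumes "c > 0" "t > 0"
  shows "c / (c\<^sup>2 + (t + 1)\<^sup>2) \<le> arctan (c / t) - arctan (c / (t + 1))"
    and "arctan (c / t) - arctan (c / (t + 1)) \<le> c / (c\<^sup>2 + t\<^sup>2)"
proof -
  have deriv: "((\<lambda>u. arctan (c / u)) has_real_derivative - (c / (c\<^sup>2 + u\<^sup>2))) (at u)" if "u > 0" for u
  proof -
    have "1 + (c / u)\<^sup>2 \<noteq> 0" by (smt (verit) zero_le_power2)
    then have "((\<lambda>u. arctan (c / u)) has_real_derivative inverse (1 + (c / u)\<^sup>2) * (- c / u\<^sup>2)) (at u)"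
      using that by (auto intro!: derivative_eq_intros simp: power2_eq_square)
    also have "inverse (1 + (c / u)\<^sup>2) * (- c / u\<^sup>2) = - (c / (c\<^sup>2 + u\<^sup>2))"
      using that by (simp add: divide_simps power2_eq_square add_ac)
    finally show ?thesis .
  qed
  \<comment> \<open>By the mean value theorem the difference is the value of
    \<open>c / (c^2 + u^2)\<close> at some \<open>u\<close> between \<open>t\<close> and
    \<open>t + 1\<close>. This value lies between those at the two ends.\<close>
  obtain u where u: "t < u" "u < t + 1"
    "arctan (c / (t + 1)) - arctan (c / t) = (t + 1 - t) * - (c / (c\<^sup>2 + u\<^sup>2))"
    using MVT2[of t "t + 1" "\<lambda>u. arctan (c / u)" "\<lambda>u. - (c / (c\<^sup>2 + u\<^sup>2))"] deriv assms by force
  have le: "t\<^sup>2 \<le> u\<^sup>2" "u\<^sup>2 \<le> (t + 1)\<^sup>2"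
    using u assms by (auto intro!: power_mono)
  have pos: "c\<^sup>2 + t\<^sup>2 > 0" "c\<^sup>2 + u\<^sup>2 > 0" using assms u by (simp_all add: add_pos_pos)
  show "c / (c\<^sup>2 + (t + 1)\<^sup>2) \<le> arctan (c / t) - arctan (c / (t + 1))"
    using u le pos assms frac_le[of c c "c\<^sup>2 + u\<^sup>2" "c\<^sup>2 + (t + 1)\<^sup>2"] by simp
  show "arctan (c / t) - arctan (c / (t + 1)) \<le> c / (c\<^sup>2 + t\<^sup>2)"
    using u le pos assms frac_le[of c c "c\<^sup>2 + t\<^sup>2" "c\<^sup>2 + u\<^sup>2"] by simp
qed

text \<open>This is the integral comparison for the tail: each term is compared with a difference of
  values of \<open>arctan (c / n)\<close>, and these differences telescope.\<close>

lemma coth_tail_bounds: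
  fixes c :: real
  assumes "c > 0" "N > 0" and sums: "(\<lambda>n. c / (c\<^sup>2 + (real (Suc n))\<^sup>2)) sums S"
  shows "S - (\<Sum>n<N. c / (c\<^sup>2 + (real (Suc n))\<^sup>2)) \<le> arctan (c / real N)"
    and "arctan (c / real N) - c / (real N)\<^sup>2 \<le> S - (\<Sum>n<N. c / (c\<^sup>2 + (real (Suc n))\<^sup>2))"
proof -
  have tail: "(\<lambda>n. c / (c\<^sup>2 + (real (Suc (n + N)))\<^sup>2)) sums (S - (\<Sum>n<N. c / (c\<^sup>2 + (real (Suc n))\<^sup>2)))"
    using sums_split_initial_segment[OF sums, of N] by simp
  have lim: "(\<lambda>n. arctan (c / real (n + k))) \<longlonglongrightarrow> 0" for k
  proof -
    have "(\<lambda>n. arctan (c / real (n + k))) \<longlonglongrightarrow> arctan 0"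
      by (intro tendsto_arctan) real_asymp
    then show ?thesis by simp
  qed
  have tele: "(\<lambda>n. arctan (c / real (n + k)) - arctan (c / real (Suc n + k))) sums arctan (c / real k)" for k
    using telescope_sums'[OF lim[of k]] by simp
  show "S - (\<Sum>n<N. c / (c\<^sup>2 + (real (Suc n))\<^sup>2)) \<le> arctan (c / real N)"
  proof (rule sums_le[OF _ tail tele])
    show "c / (c\<^sup>2 + (real (Suc (n + N)))\<^sup>2) \<le> arctan (c / real (n + N)) - arctan (c / real (Suc n + N))" for n
      using arctan_difference_bounds(1)[of c "real (n + N)"] assms by (simp add: add_ac)
  qed
  \<comment> \<open>The lower comparison starts one index later. Moving from \<open>Suc N\<close>
    back to \<open>N\<close> costs at most \<open>c / N^2\<close>, which is the loss allowed in the
    second claim.\<close>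
  have "arctan (c / real (Suc N)) \<le> S - (\<Sum>n<N. c / (c\<^sup>2 + (real (Suc n))\<^sup>2))"
  proof (rule sums_le[OF _ tele tail])
    show "arctan (c / real (n + Suc N)) - arctan (c / real (Suc n + Suc N)) \<le> c / (c\<^sup>2 + (real (Suc (n + N)))\<^sup>2)" for n
      using arctan_difference_bounds(2)[of c "real (Suc (n + N))"] assms by (simp add: add_ac)
  qed
  moreover have "arctan (c / real N) - arctan (c / real (Suc N)) \<le> c / (c\<^sup>2 + (real N)\<^sup>2)"
    using arctan_difference_bounds(2)[of c "real N"] assms by (simp add: add_ac)
  moreover have "c / (c\<^sup>2 + (real N)\<^sup>2) \<le> c / (real N)\<^sup>2"
    using assms by (intro divide_left_mono) (auto simp: add_pos_pos)
  ultimately show "arctan (c / real N) - c / (real N)\<^sup>2 \<le> S - (\<Sum>n<N. c / (c\<^sup>2 + (real (Suc n))\<^sup>2))"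
    by linarith
qed

text \<open>The square partial sums of the double series \<open>\<Sum> y / (m\<^sup>2 y\<^sup>2 + n\<^sup>2)\<close> are invariant under
  \<open>y \<mapsto> 1 / y\<close>; the two row tails left over produce the term \<open>ln y\<close>.\<close>

lemma row_sum_symmetry:
  fixes y :: real and G :: "real \<Rightarrow> nat \<Rightarrow> real"
  assumes y: "y > 0"
    and G: "\<And>c m. c > 0 \<Longrightarrow> (\<lambda>n. c / ((real (Suc m) * c)\<^sup>2 + (real (Suc n))\<^sup>2)) sums G c m"
  shows "(\<lambda>N. (\<Sum>m<N. G y m) - (\<Sum>m<N. G (1 / y) m)) \<longlonglongrightarrow> pi / 2 * ln y"
proof -
  define F where "F c N m = (\<Sum>n<N. c / ((real (Suc m) * c)\<^sup>2 + (real (Suc n))\<^sup>2))" for c :: real and N m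
  define K where "K c N m = arctan (real (Suc m) * c / real N) / real (Suc m)" for c :: real and N m
  define E where "E c N = (\<Sum>m<N. G c m) - (\<Sum>m<N. F c N m) - (\<Sum>m<N. K c N m)" for c N
  \<comment> \<open>Multiplication by \<open>M = m + 1\<close> turns the row into the series of
    \<open>coth_tail_bounds\<close> with parameter \<open>M c\<close>. Dividing the error
    \<open>M c / N^2\<close> by \<open>M\<close> makes it uniform in \<open>m\<close>, so
    \<open>N\<close> rows together err by at most \<open>c / N\<close>.\<close>
  have tail: "\<bar>G c m - F c N m - K c N m\<bar> \<le> c / (real N)\<^sup>2" if "c > 0" "N > 0" for c N m
  proof -
    define M where "M = real (Suc m)"
    have M: "M > 0" by (simp add: M_def)
    have sums: "(\<lambda>n. M * c / ((M * c)\<^sup>2 + (real (Suc n))\<^sup>2)) sums (M * G c m)"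
      using sums_mult[OF G[OF that(1), of m], of M] by (simp add: M_def)
    have F: "M * F c N m = (\<Sum>n<N. M * c / ((M * c)\<^sup>2 + (real (Suc n))\<^sup>2))"
      by (simp add: F_def M_def sum_distrib_left)
    have K: "M * K c N m = arctan (M * c / real N)"
      by (simp add: K_def M_def)
    have "M * G c m - M * F c N m - M * K c N m \<le> 0"
         "- (M * c / (real N)\<^sup>2) \<le> M * G c m - M * F c N m - M * K c N m"
      using coth_tail_bounds[OF _ that(2) sums] M that(1) unfolding F K by simp_all
    then have "\<bar>M * (G c m - F c N m - K c N m)\<bar> \<le> M * (c / (real N)\<^sup>2)"
      by (simp add: algebra_simps)
    then show ?thesis
      using M by (simp only: abs_mult abs_of_pos mult_le_cancel_left_pos)
  qed
  have E: "E c \<longlonglongrightarrow> 0" if "c > 0" for c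
  proof (rule Lim_null_comparison)
    show "(\<lambda>N. c / real N) \<longlonglongrightarrow> 0" by real_asymp
    show "\<forall>\<^sub>F N in sequentially. norm (E c N) \<le> c / real N"
      using eventually_gt_at_top[of 0]
    proof eventually_elim
      case (elim N)
      have "\<bar>E c N\<bar> \<le> (\<Sum>m<N. \<bar>G c m - F c N m - K c N m\<bar>)"
        unfolding E_def sum_subtractf[symmetric] by (rule sum_abs)
      also have "\<dots> \<le> (\<Sum>m<N. c / (real N)\<^sup>2)"
        using tail that elim by (intro sum_mono) auto
      also have "\<dots> = c / real N"
        using elim by (simp add: power2_eq_square)
      finally show ?case by simp
    qed
  qed
  have "(\<Sum>m<N. F (1 / y) N m) = (\<Sum>m<N. F y N m)" for N
  proof -
    have "1 / y / ((real (Suc m) * (1 / y))\<^sup>2 + (real (Suc n))\<^sup>2)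
        = y / ((real (Suc n) * y)\<^sup>2 + (real (Suc m))\<^sup>2)" for m n
      using y by (simp add: divide_simps power2_eq_square add_ac mult_ac)
    then have "(\<Sum>m<N. F (1 / y) N m) = (\<Sum>m<N. \<Sum>n<N. y / ((real (Suc n) * y)\<^sup>2 + (real (Suc m))\<^sup>2))"
      by (simp only: F_def)
    also have "\<dots> = (\<Sum>m<N. F y N m)"
      unfolding F_def by (rule sum.swap)
    finally show ?thesis .
  qed
  then have "(\<Sum>m<N. G y m) - (\<Sum>m<N. G (1 / y) m)
      = E y N - E (1 / y) N + ((\<Sum>m<N. K y N m) - (\<Sum>m<N. K (1 / y) N m))" for N
    by (simp add: E_def)
  moreover have "(\<lambda>N. E y N - E (1 / y) N + ((\<Sum>m<N. K y N m) - (\<Sum>m<N. K (1 / y) N m)))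
      \<longlonglongrightarrow> 0 - 0 + pi / 2 * ln y"
    using arctan_sum_diff_tendsto[OF y] y unfolding K_def
    by (intro tendsto_add tendsto_diff E) auto
  ultimately show ?thesis by simp
qed

section \<open>The inversion formula\<close>

lemma euler_phi_pos:
  fixes x :: real
  assumes "0 \<le> x" "x < 1"
  shows "euler_phi x > 0"
proof (rule has_prod_pos[OF has_prod_euler_phi[OF assms]])
  show "0 < 1 - x ^ Suc n" for n
    using assms power_Suc_less_one[of x n] by (cases "x = 0") auto
qed

text \<open>Partial fractions split \<open>G c m\<close> into \<open>pi / (2 (m + 1))\<close>, a
  Lambert term and \<open>-1 / (2 c (m + 1)^2)\<close>. The first part is independent of
  \<open>c\<close> and cancels between \<open>y\<close> and \<open>1 / y\<close>. The second sums to
  \<open>- pi\<close> times the logarithm, the third to \<open>- pi^2 / (12 c)\<close>. Comparison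
  with the limit in \<open>row_sum_symmetry\<close> gives the formula.\<close>

lemma ln_euler_phi_inversion:
  fixes y :: real
  assumes "y > 0"
  shows "ln (euler_phi (exp (- 2 * pi / y))) - ln (euler_phi (exp (- 2 * pi * y)))
           = ln y / 2 + pi / 12 * (1 / y - y)"
proof -
  define L where "L c = ln (euler_phi (exp (- 2 * pi * c)))" for c
  define G where "G c m = c * ((pi + 2 * pi / (exp (2 * pi * (real (Suc m) * c)) - 1) - 1 / (real (Suc m) * c))
      / (2 * (real (Suc m) * c)))" for c m
  have G: "(\<lambda>n. c / ((real (Suc m) * c)\<^sup>2 + (real (Suc n))\<^sup>2)) sums G c m" if "c > 0" for c m
    using sums_mult[OF coth_partial_fractions[of "real (Suc m) * c"], of c] that by (simp add: G_def)
  have L: "(\<lambda>m. G c m - pi / (2 * real (Suc m))) sums (- pi * L c - pi\<^sup>2 / (12 * c))" if c: "c > 0" for c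
  proof -
    define x where "x = exp (- 2 * pi * c)"
    have x: "0 < x" "x < 1" using c by (auto simp: x_def)
    have sums: "(\<lambda>m. - pi * - (x ^ Suc m / (real (Suc m) * (1 - x ^ Suc m))) - 1 / (2 * c) * (1 / real ((m + 1)\<^sup>2)))
        sums (- pi * L c - 1 / (2 * c) * (pi\<^sup>2 / 6))"
      unfolding L_def x_def[symmetric]
      using sums_diff[OF sums_mult[OF ln_euler_phi_sums[OF x], of "- pi"] sums_mult[OF inverse_squares_sums, of "1 / (2 * c)"]] .
    have "- pi * - (x ^ Suc m / (real (Suc m) * (1 - x ^ Suc m))) - 1 / (2 * c) * (1 / real ((m + 1)\<^sup>2))
        = G c m - pi / (2 * real (Suc m))" for m
    proof -
      define M where "M = real (Suc m)"
      define e where "e = exp (2 * pi * (M * c))"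
      have M: "M > 0" "real ((m + 1)\<^sup>2) = M\<^sup>2" "real (Suc m) = M" by (simp_all add: M_def power2_eq_square algebra_simps)
      have e: "e > 1" using M c by (auto simp: e_def)
      have xe: "x ^ Suc m = 1 / e"
      proof -
        have "real (Suc m) * (- 2 * pi * c) = - (2 * pi * (M * c))"
          by (simp add: M_def)
        then show ?thesis
          unfolding x_def e_def exp_of_nat_mult[symmetric] by (simp only: exp_minus inverse_eq_divide)
      qed
      have "x ^ Suc m / (1 - x ^ Suc m) = 1 / (e - 1)"
        unfolding xe using e by (simp add: divide_simps)
      then have *: "x ^ Suc m / (M * (1 - x ^ Suc m)) = 1 / (e - 1) / M"
        by (metis divide_divide_eq_left mult.commute)
      define r where "r = 1 / (e - 1)"
      have r: "2 * pi / (e - 1) = 2 * pi * r" by (simp add: r_def)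
      show ?thesis
        unfolding M * G_def e_def[symmetric] r unfolding r_def[symmetric]
        using M(1) c by (simp add: field_simps power2_eq_square)
    qed
    with sums have "(\<lambda>m. G c m - pi / (2 * real (Suc m))) sums (- pi * L c - 1 / (2 * c) * (pi\<^sup>2 / 6))"
      by (simp only:)
    then show ?thesis by simp
  qed
  have "(\<lambda>N. (\<Sum>m<N. G y m) - (\<Sum>m<N. G (1 / y) m)) \<longlonglongrightarrow>
      (- pi * L y - pi\<^sup>2 / (12 * y)) - (- pi * L (1 / y) - pi\<^sup>2 / (12 * (1 / y)))"
  proof -
    have "(\<lambda>m. (G y m - pi / (2 * real (Suc m))) - (G (1 / y) m - pi / (2 * real (Suc m)))) sums
        ((- pi * L y - pi\<^sup>2 / (12 * y)) - (- pi * L (1 / y) - pi\<^sup>2 / (12 * (1 / y))))"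
      using assms by (intro sums_diff L) auto
    then show ?thesis
      by (simp add: sums_def sum_subtractf)
  qed
  from LIMSEQ_unique[OF this row_sum_symmetry[OF assms G]]
  have "pi * (L (1 / y) - L y) = pi * (ln y / 2 + pi / 12 * (1 / y - y))"
    using assms by (simp add: field_simps power2_eq_square)
  then have "L (1 / y) - L y = ln y / 2 + pi / 12 * (1 / y - y)"
    by (simp only: mult_cancel_left pi_neq_zero simp_thms)
  then show ?thesis by (simp add: L_def)
qed

text \<open>This is the weight 12 transformation of the discriminant. After multiplication by 24,
  the term \<open>pi / 12 * (1 / y - y)\<close> is absorbed by the exponential prefactors, and
  \<open>ln y / 2\<close> becomes \<open>ln (y ^ 12)\<close>.\<close>

lemma Delta_inversion:
  fixes y :: real
  assumes "y > 0"
  shows "exp (- 2 * pi / y) * euler_phi (exp (- 2 * pi / y)) ^ 24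
           = y ^ 12 * (exp (- 2 * pi * y) * euler_phi (exp (- 2 * pi * y)) ^ 24)"
proof -
  define u where "u = euler_phi (exp (- 2 * pi / y))"
  define v where "v = euler_phi (exp (- 2 * pi * y))"
  have pos: "u > 0" "v > 0" unfolding u_def v_def using assms by (auto intro!: euler_phi_pos)
  have "ln u = ln v + (ln y / 2 + pi / 12 * (1 / y - y))"
    using ln_euler_phi_inversion[OF assms] by (simp add: u_def v_def)
  moreover have "ln (exp (- 2 * pi / y) * u ^ 24) = - 2 * pi / y + 24 * ln u"
    and "ln (y ^ 12 * (exp (- 2 * pi * y) * v ^ 24)) = 12 * ln y + (- 2 * pi * y + 24 * ln v)"
    using pos assms by (simp_all add: ln_mult ln_realpow)
  ultimately have "ln (exp (- 2 * pi / y) * u ^ 24) = ln (y ^ 12 * (exp (- 2 * pi * y) * v ^ 24))"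
    using assms by (simp only:) (simp add: field_simps)
  then show ?thesis
    using pos assms by (simp add: u_def v_def)
qed

text \<open>At \<open>y = sqrt a\<close> the inversion exchanges \<open>nome a\<close> and
  \<open>Nome a\<close>, and \<open>y ^ 12 = a ^ 6\<close>. This is where the constant
  \<open>a ^ 6\<close> of the theorem comes from.\<close>

lemma Delta_nome:
  assumes "a > 0"
  shows "nome a * euler_phi (nome a) ^ 24 = real a ^ 6 * (Nome a * euler_phi (Nome a) ^ 24)"
proof -
  have "sqrt (real a) ^ 12 = (sqrt (real a) ^ 2) ^ 6"
    by (simp only: power_mult[symmetric]) simp
  then show ?thesis
    using Delta_inversion[of "sqrt (real a)"] assms by (simp add: Nome_eq nome_def)
qed

section \<open>Quotients of power series\<close>

lemma euler_phi_bounds: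
  fixes x :: real
  assumes "0 \<le> x" "x \<le> 1 / 2"
  shows "1 - x - 2 * x\<^sup>2 \<le> euler_phi x" and "euler_phi x \<le> 1 - x"
proof -
  have lim: "(\<lambda>n. \<Prod>k\<le>n. 1 - x ^ Suc k) \<longlonglongrightarrow> euler_phi x"
    using assms by (intro has_prod_imp_tendsto has_prod_euler_phi) auto
  have pow: "0 \<le> x ^ k" "x ^ k \<le> 1" for k
    using assms by (auto intro: power_le_one)
  \<comment> \<open>Weierstrass: a product of factors \<open>1 - t\<close> is at least one minus the
    sum of the \<open>t\<close>. The powers from \<open>x^2\<close> on sum to at most
    \<open>x^2 / (1 - x)\<close>, hence to at most twice \<open>x^2\<close>.\<close>
  have "1 - x - 2 * x\<^sup>2 \<le> (\<Prod>k\<le>n. 1 - x ^ Suc k)" for n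
  proof -
    have "(\<lambda>k. x\<^sup>2 * x ^ k) sums (x\<^sup>2 * (1 / (1 - x)))"
      using assms by (intro sums_mult geometric_sums) auto
    then have "(\<Sum>k<n. x\<^sup>2 * x ^ k) \<le> x\<^sup>2 * (1 / (1 - x))"
      using sum_le_suminf[of "\<lambda>k. x\<^sup>2 * x ^ k" "{..<n}"] pow by (simp add: sums_iff)
    also have "\<dots> \<le> x\<^sup>2 * 2"
      using assms by (intro mult_left_mono) (auto simp: divide_simps)
    finally have "(\<Sum>k\<le>n. x ^ Suc k) \<le> x + 2 * x\<^sup>2"
      by (simp add: lessThan_Suc_atMost[symmetric] sum.lessThan_Suc_shift power2_eq_square mult_ac del: sum.lessThan_Suc)
    moreover have "1 - (\<Sum>k\<le>n. x ^ Suc k) \<le> (\<Prod>k\<le>n. 1 - x ^ Suc k)"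
      using pow by (intro Weierstrass_prod_ineq) (auto simp del: power_Suc)
    ultimately show ?thesis by simp
  qed
  then show "1 - x - 2 * x\<^sup>2 \<le> euler_phi x"
    by (intro LIMSEQ_le_const[OF lim]) auto
  have "(\<Prod>k\<le>n. 1 - x ^ Suc k) \<le> 1 - x" for n
  proof -
    have "(\<Prod>k\<le>n. 1 - x ^ Suc k) = (1 - x) * (\<Prod>k<n. 1 - x ^ Suc (Suc k))"
      by (simp add: lessThan_Suc_atMost[symmetric] prod.lessThan_Suc_shift del: prod.lessThan_Suc)
    also have "\<dots> \<le> (1 - x) * 1"
      using assms pow by (intro mult_left_mono prod_le_1) (auto simp del: power_Suc)
    finally show ?thesis by simp
  qed
  then show "euler_phi x \<le> 1 - x"
    by (intro LIMSEQ_le_const2[OF lim]) auto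
qed

text \<open>Truncating the alternating binomial expansion after the quadratic term overestimates:
  the induction step discards only a nonpositive cubic term.\<close>

lemma power_one_minus_le:
  fixes x :: real
  assumes "0 \<le> x" "x \<le> 1"
  shows "(1 - x) ^ n \<le> 1 - real n * x + real n * (real n - 1) / 2 * x\<^sup>2"
proof (induction n)
  case (Suc n)
  have "(1 - x) ^ Suc n \<le> (1 - x) * (1 - real n * x + real n * (real n - 1) / 2 * x\<^sup>2)"
    using Suc assms by (simp add: mult_left_mono)
  also have "\<dots> = 1 - real (Suc n) * x + real (Suc n) * (real (Suc n) - 1) / 2 * x\<^sup>2
      - real n * (real n - 1) / 2 * x ^ 3"
    by (simp add: field_simps power2_eq_square power3_eq_cube)
  also have "\<dots> \<le> 1 - real (Suc n) * x + real (Suc n) * (real (Suc n) - 1) / 2 * x\<^sup>2"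
    using assms by (cases n) auto
  finally show ?case .
qed simp

text \<open>The constant 276 is the binomial coefficient 24 over 2, from the upper bound
  \<open>(1 - x) ^ 24\<close>. The lower bound, by Bernoulli's inequality, loses only
  \<open>48 x^2\<close>.\<close>

lemma euler_phi_power_24:
  fixes x :: real
  assumes "0 \<le> x" "x \<le> 1 / 2"
  shows "\<bar>euler_phi x ^ 24 - (1 - 24 * x)\<bar> \<le> 276 * x\<^sup>2"
proof -
  have "2 * x\<^sup>2 \<le> 2 * (1 / 2)\<^sup>2"
    using assms by (intro mult_left_mono power_mono) auto
  then have t: "x + 2 * x\<^sup>2 \<le> 1" using assms by (simp add: power2_eq_square)
  have "1 - 24 * x - 276 * x\<^sup>2 \<le> 1 + real 24 * (- (x + 2 * x\<^sup>2))"
    using zero_le_power2[of x] by (simp add: algebra_simps)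
  also have "\<dots> \<le> (1 + (- (x + 2 * x\<^sup>2))) ^ 24"
    using t by (intro Bernoulli_inequality) auto
  also have "\<dots> \<le> euler_phi x ^ 24"
    using euler_phi_bounds(1)[OF assms] t by (intro power_mono) auto
  finally have "1 - 24 * x - 276 * x\<^sup>2 \<le> euler_phi x ^ 24" .
  moreover have "euler_phi x ^ 24 \<le> (1 - x) ^ 24"
    using euler_phi_bounds(2)[OF assms] euler_phi_pos[of x] assms by (intro power_mono) auto
  moreover have "(1 - x) ^ 24 \<le> 1 - 24 * x + 276 * x\<^sup>2"
    using power_one_minus_le[of x 24] assms by simp
  ultimately show ?thesis by linarith
qed

section \<open>Coefficient bounds and perturbation of formal quotients\<close>

lemma fps_quotient_nth_bound:
  fixes e x y :: "real fps"
  assumes eq: "y * e = x"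
    and e: "\<bar>fps_nth e 0\<bar> \<ge> 1 / 2" "\<And>j. j > 0 \<Longrightarrow> \<bar>fps_nth e j\<bar> \<le> 25"
    and x: "\<And>j. j \<le> k \<Longrightarrow> \<bar>fps_nth x j\<bar> \<le> M"
  shows "\<bar>fps_nth y k\<bar> \<le> 2 * M * 51 ^ k"
  using x
proof (induction k rule: less_induct)
  case (less k)
  have M: "M \<ge> 0" using less.prems[of 0] by (smt (verit) zero_le)
  \<comment> \<open>The base is \<open>51 = 2 * 25 + 1\<close>: the earlier coefficients then
    contribute at most \<open>2 M * 25 * (51 ^ k - 1) / 50 = M (51 ^ k - 1)\<close>. With
    \<open>M\<close> from the right-hand side the total is \<open>M * 51 ^ k\<close>, and dividing
    by the constant coefficient at most doubles it.\<close>
  have geo: "(\<Sum>i<n. (51::real) ^ i) = (51 ^ n - 1) / 50" for n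
    using geometric_sum[of "51::real" n] by simp
  have "fps_nth x k = (\<Sum>i<k. fps_nth y i * fps_nth e (k - i)) + fps_nth y k * fps_nth e 0"
    unfolding eq[symmetric] fps_mult_nth
    by (simp add: atLeast0AtMost lessThan_Suc_atMost[symmetric])
  then have "fps_nth y k * fps_nth e 0 = fps_nth x k - (\<Sum>i<k. fps_nth y i * fps_nth e (k - i))"
    by simp
  then have "\<bar>fps_nth y k\<bar> * \<bar>fps_nth e 0\<bar> \<le> \<bar>fps_nth x k\<bar> + \<bar>\<Sum>i<k. fps_nth y i * fps_nth e (k - i)\<bar>"
    by (metis abs_mult abs_triangle_ineq4)
  also have "\<bar>\<Sum>i<k. fps_nth y i * fps_nth e (k - i)\<bar> \<le> (\<Sum>i<k. 2 * M * 51 ^ i * 25)"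
  proof (rule order_trans[OF sum_abs], rule sum_mono)
    fix i assume "i \<in> {..<k}"
    then show "\<bar>fps_nth y i * fps_nth e (k - i)\<bar> \<le> 2 * M * 51 ^ i * 25"
      unfolding abs_mult using less.IH[of i] less.prems e(2)[of "k - i"] M
      by (intro mult_mono) auto
  qed
  also have "(\<Sum>i<k. 2 * M * 51 ^ i * 25) = M * (51 ^ k - 1)"
    unfolding sum_distrib_right[symmetric] sum_distrib_left[symmetric] geo by simp
  finally have "\<bar>fps_nth y k\<bar> * \<bar>fps_nth e 0\<bar> \<le> M * 51 ^ k"
    using less.prems[of k] by (simp add: algebra_simps)
  moreover have "\<bar>fps_nth y k\<bar> * (1 / 2) \<le> \<bar>fps_nth y k\<bar> * \<bar>fps_nth e 0\<bar>"
    using e(1) by (intro mult_left_mono) auto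
  ultimately show ?case by simp
qed

text \<open>The limits of the rescaled series are \<open>(1 + 23 u) / (1 - u)\<close> for the denominator and
  \<open>(q u + (24 q\<^sup>2 - q) u\<^sup>2) / (1 - u)\<close> for the numerator.\<close>

definition limit_quotient :: "real \<Rightarrow> real fps" where
  "limit_quotient q = Abs_fps (\<lambda>k. if k = 0 then 0 else if k = 1 then q else 24 * q * (q - 1) * (- 23) ^ (k - 2))"

definition limit_denominator :: "real fps" where
  "limit_denominator = Abs_fps (\<lambda>k. if k = 0 then 1 else 24)"

definition limit_numerator :: "real \<Rightarrow> real fps" where
  "limit_numerator q = Abs_fps (\<lambda>k. if k = 0 then 0 else if k = 1 then q else 24 * q\<^sup>2)"

text \<open>Multiplication by \<open>1 - X\<close> turns the denominator into
  \<open>1 + 23 X\<close>. The geometric coefficients of the quotient telescope against this factor,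
  and \<open>1 - X\<close> is cancelled at the end.\<close>

lemma limit_quotient_mult:
  "limit_quotient q * limit_denominator = limit_numerator q"
proof -
  let ?X = "fps_X :: real fps"
  have "(1 - ?X) * limit_denominator = 1 + fps_const 23 * ?X"
    by (rule fps_ext) (simp add: limit_denominator_def left_diff_distrib)
  moreover have "(1 + fps_const 23 * ?X) * limit_quotient q = (1 - ?X) * limit_numerator q"
  proof (rule fps_ext)
    fix k :: nat
    consider "k = 0" | "k = 1" | "k = 2" | m where "k = Suc (Suc (Suc m))"
      by (metis One_nat_def Suc_1 not0_implies_Suc)
    then show "fps_nth ((1 + fps_const 23 * ?X) * limit_quotient q) k = fps_nth ((1 - ?X) * limit_numerator q) k"
      by cases (simp_all add: limit_quotient_def limit_numerator_def distrib_right left_diff_distrib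
          mult.assoc algebra_simps power2_eq_square)
  qed
  ultimately have "(1 - ?X) * (limit_quotient q * limit_denominator) = (1 - ?X) * limit_numerator q"
    by (metis mult.left_commute mult.commute)
  moreover have "1 - ?X \<noteq> 0"
    by (metis fps_X_neq_one eq_iff_diff_eq_0)
  ultimately show ?thesis by simp
qed

text \<open>The difference of the quotients is itself a quotient with denominator \<open>e\<close>.
  Its numerator is the numerator error minus \<open>limit_quotient q\<close> times the denominator
  error, so \<open>fps_quotient_nth_bound\<close> applies again.\<close>

lemma limit_quotient_perturbation:
  fixes e x y :: "real fps"
  assumes eq: "y * e = x" and q: "0 \<le> q" "q \<le> 1" and \<epsilon>: "0 \<le> \<epsilon>"
    and e: "\<bar>fps_nth e 0\<bar> \<ge> 1 / 2" "\<And>j. j > 0 \<Longrightarrow> \<bar>fps_nth e j\<bar> \<le> 25"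
    and e': "\<And>j. \<bar>fps_nth e j - fps_nth limit_denominator j\<bar> \<le> \<epsilon>"
    and x': "\<And>j. \<bar>fps_nth x j - fps_nth (limit_numerator q) j\<bar> \<le> \<delta>"
  shows "\<bar>fps_nth y k - fps_nth (limit_quotient q) k\<bar> \<le> 2 * (\<delta> + real (Suc k) * (24 * 23 ^ k) * \<epsilon>) * 51 ^ k"
proof -
  let ?B = "limit_quotient q"
  have B: "\<bar>fps_nth ?B i\<bar> \<le> 24 * 23 ^ i" for i
  proof -
    consider "i = 0" | "i = 1" | m where "i = Suc (Suc m)"
      by (metis One_nat_def not0_implies_Suc)
    then show ?thesis
    proof cases
      case 3
      have "\<bar>fps_nth ?B i\<bar> = 24 * (q * (1 - q)) * 23 ^ m"
        using q 3 by (simp add: limit_quotient_def abs_mult power_abs)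
      also have "\<dots> \<le> 24 * (1 * 1) * 23 ^ m"
        using q by (intro mult_mono) auto
      also have "\<dots> \<le> 24 * 23 ^ i" using 3 by simp
      finally show ?thesis .
    qed (use q in \<open>auto simp: limit_quotient_def\<close>)
  qed
  have "(y - ?B) * e = (x - limit_numerator q) - ?B * (e - limit_denominator)"
    by (simp add: eq left_diff_distrib right_diff_distrib limit_quotient_mult)
  then have "\<bar>fps_nth (y - ?B) k\<bar> \<le> 2 * (\<delta> + real (Suc k) * (24 * 23 ^ k) * \<epsilon>) * 51 ^ k"
  proof (rule fps_quotient_nth_bound[OF _ e])
    fix j assume j: "j \<le> k"
    have "\<bar>fps_nth (?B * (e - limit_denominator)) j\<bar> \<le> (\<Sum>i=0..j. 24 * 23 ^ k * \<epsilon>)"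
      unfolding fps_mult_nth
    proof (rule order_trans[OF sum_abs], rule sum_mono)
      fix i assume i: "i \<in> {0..j}"
      have "\<bar>fps_nth ?B i\<bar> \<le> 24 * 23 ^ k"
        using i j power_increasing[of i k "23::real"] by (intro order_trans[OF B]) auto
      then show "\<bar>fps_nth ?B i * fps_nth (e - limit_denominator) (j - i)\<bar> \<le> 24 * 23 ^ k * \<epsilon>"
        unfolding abs_mult using e' by (intro mult_mono) auto
    qed
    also have "\<dots> = real (Suc j) * (24 * 23 ^ k * \<epsilon>)" by simp
    also have "\<dots> \<le> real (Suc k) * (24 * 23 ^ k * \<epsilon>)"
      using j \<epsilon> by (intro mult_right_mono) auto
    finally show "\<bar>fps_nth ((x - limit_numerator q) - ?B * (e - limit_denominator)) j\<bar>
        \<le> \<delta> + real (Suc k) * (24 * 23 ^ k) * \<epsilon>"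
      using x'[of j] by (simp add: mult_ac)
  qed
  then show ?thesis by simp
qed

section \<open>Averaging over roots of unity\<close>

text \<open>Multiplication by a primitive root \<open>w\<close> permutes the roots and multiplies
  the sum by \<open>w ^ k\<close>, which differs from 1.\<close>

lemma sum_roots_of_unity_power:
  assumes "0 < k" "k < d"
  shows "(\<Sum>z::complex | z ^ d = 1. z ^ k) = 0"
proof -
  define w where "w = cis (2 * pi / real d)"
  have d: "d > 0" using assms by simp
  have wd: "w ^ d = 1" unfolding w_def Complex.DeMoivre using d by simp
  then have w0: "w \<noteq> 0" using d by (auto simp: power_0_left)
  have inj: "inj_on (\<lambda>k. cis (2 * pi * real k / real d)) {..<d}"
    using Complex.bij_betw_roots_unity[OF d] by (rule bij_betw_imp_inj_on)
  have "w ^ k = cis (2 * pi * real k / real d)"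
    by (simp add: w_def Complex.DeMoivre mult_ac)
  then have wk: "w ^ k \<noteq> 1"
    using inj_onD[OF inj, of k 0] assms by auto
  have "(\<Sum>z | z ^ d = 1. z ^ k) = (\<Sum>z | z ^ d = 1. (w * z) ^ k)"
  proof (rule sum.reindex_bij_witness[of _ "\<lambda>z. w * z" "\<lambda>z. z / w"])
  qed (use wd w0 in \<open>auto simp: power_mult_distrib power_divide\<close>)
  also have "\<dots> = w ^ k * (\<Sum>z | z ^ d = 1. z ^ k)"
    by (simp add: power_mult_distrib sum_distrib_left)
  finally show ?thesis using wk by simp
qed

text \<open>Up to index \<open>d\<close> only \<open>c d\<close> survives the averaging. A bound on
  all later terms in absolute value suffices: their geometric tail has factor
  \<open>1 / (1 - r)\<close>, at most 2.\<close>

lemma roots_of_unity_filter_bound: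
  fixes c :: "nat \<Rightarrow> real"
  assumes d: "d > 0" and c0: "c 0 = 0" and r: "0 \<le> r" "r \<le> 1 / 2" and c: "\<And>k. \<bar>c k\<bar> \<le> M * r ^ k"
  shows "norm (1 / of_nat d * (\<Sum>z::complex | z ^ d = 1. \<Sum>k. of_real (c k) * z ^ k) - of_real (c d))
           \<le> 2 * M * r ^ Suc d"
proof -
  let ?U = "{z::complex. z ^ d = 1}"
  have U: "finite ?U" "card ?U = d"
    using d finite_roots_unity[of d] card_roots_unity_eq[of d] by auto
  have nz: "norm z = 1" if "z \<in> ?U" for z
    using that d power_eq_1_iff[of z d] by simp
  define T where "T z = (\<Sum>k. of_real (c (k + Suc d)) * z ^ (k + Suc d))" for z :: complex
  have geo: "(\<lambda>k. M * r ^ (k + Suc d)) sums (M * r ^ Suc d * (1 / (1 - r)))"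
    using sums_mult[OF geometric_sums[of r], of "M * r ^ Suc d"] r by (simp add: power_add mult_ac)
  have M: "M \<ge> 0" using c[of 0] by simp
  have T: "norm (T z) \<le> 2 * M * r ^ Suc d" if "z \<in> ?U" for z
  proof -
    have "norm (T z) \<le> (\<Sum>k. M * r ^ (k + Suc d))"
      unfolding T_def using nz[OF that] c geo
      by (intro norm_suminf_le) (auto simp: norm_mult norm_power sums_iff simp del: power_Suc)
    also have "\<dots> = M * r ^ Suc d * (1 / (1 - r))"
      using geo by (simp only: sums_iff)
    also have "\<dots> \<le> M * r ^ Suc d * 2"
      using M r by (intro mult_left_mono mult_nonneg_nonneg) (auto simp: divide_simps)
    finally show ?thesis by (simp add: mult_ac)
  qed
  have split: "(\<Sum>k. of_real (c k) * z ^ k) = T z + (\<Sum>k<Suc d. of_real (c k) * z ^ k)" if "z \<in> ?U" for z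
  proof -
    have "summable (\<lambda>k. of_real (c k) * z ^ k)"
    proof (rule summable_comparison_test')
      show "summable (\<lambda>k. M * r ^ k)" using r by (intro summable_mult summable_geometric) auto
      show "norm (of_real (c k) * z ^ k) \<le> M * r ^ k" for k
        using nz[OF that] c by (simp add: norm_mult norm_power)
    qed
    then show ?thesis unfolding T_def by (rule suminf_split_initial_segment)
  qed
  have "(\<Sum>z\<in>?U. \<Sum>k<Suc d. of_real (c k) * z ^ k) = (\<Sum>k<Suc d. of_real (c k) * (\<Sum>z\<in>?U. z ^ k))"
    by (subst sum.swap) (simp add: sum_distrib_left)
  also have "\<dots> = (\<Sum>k<Suc d. if k = d then of_real (c d) * of_nat d else 0)"
  proof (rule sum.cong)
    fix k assume "k \<in> {..<Suc d}"
    then consider "k = d" | "k = 0" | "0 < k" "k < d" by force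
    then show "of_real (c k) * (\<Sum>z\<in>?U. z ^ k) = (if k = d then of_real (c d) * of_nat d else 0)"
      using U c0 d sum_roots_of_unity_power by cases auto
  qed simp
  also have "\<dots> = of_real (c d) * of_nat d" by simp
  finally have main: "(\<Sum>z\<in>?U. \<Sum>k. of_real (c k) * z ^ k) = (\<Sum>z\<in>?U. T z) + of_real (c d) * of_nat d"
    using split by (simp add: sum.distrib)
  have "norm (\<Sum>z\<in>?U. T z) \<le> (\<Sum>z\<in>?U. 2 * M * r ^ Suc d)"
    using T by (intro sum_norm_le)
  then have "norm (\<Sum>z\<in>?U. T z) \<le> of_nat d * (2 * M * r ^ Suc d)"
    using U by simp
  then have "norm (\<Sum>z\<in>?U. T z) / of_nat d \<le> 2 * M * r ^ Suc d"
    using d by (simp add: divide_le_eq mult_ac)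
  moreover have "1 / of_nat d * (\<Sum>z\<in>?U. \<Sum>k. of_real (c k) * z ^ k) - of_real (c d) = (\<Sum>z\<in>?U. T z) / of_nat d"
    using d unfolding main by (simp add: field_simps)
  ultimately show ?thesis by (simp add: norm_divide)
qed

lemma sums_times_one_minus:
  fixes a :: "nat \<Rightarrow> 'a :: real_normed_field"
  assumes "a sums S"
  shows "(\<lambda>k. a k - (if k = 0 then 0 else c * a (k - 1))) sums ((1 - c) * S)"
proof -
  have "(\<lambda>k. if k = 0 then 0 else c * a (k - 1)) sums (c * S)"
    using sums_mult[OF assms, of c] sums_Suc_iff[of "\<lambda>k. if k = 0 then 0 else c * a (k - 1)" "c * S"] by simp
  from sums_diff[OF assms this] show ?thesis by (simp add: left_diff_distrib)
qed

section \<open>The rescaled numerator and denominator\<close>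

definition phi24 :: "real \<Rightarrow> real" where
  "phi24 x = euler_phi x ^ 24"

text \<open>\<open>A\<close> stands for \<open>a ^ 6\<close>; its relation to \<open>q\<close> and
  \<open>Q\<close> enters later as the hypothesis \<open>inv\<close>. The threshold 1/600 keeps
  \<open>576 * Q\<close> below 1, so that denominator coefficients of positive index are at most
  25.\<close>

locale eta_quotient =
  fixes q Q A :: real
  assumes q: "0 < q" "q < 1" and Q: "0 < Q" "Q \<le> 1 / 600" and A: "A \<ge> 1"
begin

text \<open>With \<open>u = z Q\<^sup>2\<close>, the following are the coefficients in \<open>u\<close> of \<open>(1 - z Q) D z / Q\<close> and of
  \<open>Q (1 - z Q) (N z - A D z)\<close>.\<close>

definition den_coeff :: "nat \<Rightarrow> real" where
  "den_coeff k = (if k = 0 then phi24 Q else (phi24 (Q ^ Suc k) - phi24 (Q ^ k)) / Q ^ k)"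

definition num_coeff :: "nat \<Rightarrow> real" where
  "num_coeff k = (if k = 0 then 0 else if k = 1 then q * phi24 (q * Q) - A * Q * phi24 (Q\<^sup>2)
     else q * ((phi24 (q * Q ^ k) - phi24 (q * Q ^ (k - 1))) / Q ^ (k - 1)) - A * Q\<^sup>2 * den_coeff k)"

lemma phi24_approx: "0 \<le> x \<Longrightarrow> x \<le> 1 / 2 \<Longrightarrow> \<bar>phi24 x - (1 - 24 * x)\<bar> \<le> 276 * x\<^sup>2"
  unfolding phi24_def by (rule euler_phi_power_24)

lemma phi24_bounds: "0 \<le> x \<Longrightarrow> x \<le> 1 / 2 \<Longrightarrow> 0 \<le> phi24 x \<and> phi24 x \<le> 1"
  using euler_phi_bounds(2)[of x] euler_phi_pos[of x] by (auto simp: phi24_def power_le_one)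

lemma Q_power_le: "0 < Q ^ k" "Q ^ Suc k \<le> Q"
  using Q power_decreasing[of 1 "Suc k" Q] by auto

text \<open>Linearize \<open>phi24\<close> at both points. The two quadratic errors contribute 276
  each and the part \<open>24 s Q^(k+1)\<close> of the linear term another 24, in total 576. The
  denominator uses \<open>s = 1\<close>, the numerator \<open>s = q\<close>.\<close>

lemma phi24_difference:
  assumes s: "0 < s" "s \<le> 1" and k: "k > 0"
  shows "\<bar>(phi24 (s * Q ^ Suc k) - phi24 (s * Q ^ k)) / Q ^ k - 24 * s\<bar> \<le> 576 * Q"
proof -
  define t where "t = Q ^ k"
  have t: "0 < t" "t \<le> Q"
    using Q_power_le[of "k - 1"] k Q by (auto simp: t_def)
  have st: "0 \<le> s * t" "s * t \<le> t"
    using s t by (auto simp: mult_le_cancel_right1)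
  have stQ: "0 \<le> s * t * Q" "s * t * Q \<le> s * t"
    using st Q by (auto simp: mult_le_cancel_left1 intro!: mult_right_le_one_le)
  have half: "s * t \<le> 1 / 2" "s * t * Q \<le> 1 / 2"
    using st t Q stQ by linarith+
  have sq: "(s * t)\<^sup>2 \<le> t * Q" "(s * t * Q)\<^sup>2 \<le> t * Q"
    unfolding power2_eq_square using st stQ t by (intro mult_mono; linarith)+
  have "\<bar>phi24 (s * t * Q) - (1 - 24 * (s * t * Q))\<bar> \<le> 276 * (t * Q)"
    using phi24_approx[OF stQ(1) half(2)] sq by simp
  moreover have "\<bar>phi24 (s * t) - (1 - 24 * (s * t))\<bar> \<le> 276 * (t * Q)"
    using phi24_approx[OF st(1) half(1)] sq by simp
  moreover have "s * t * Q \<le> t * Q"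
    using st Q by (intro mult_right_mono) auto
  ultimately have "\<bar>phi24 (s * t * Q) - phi24 (s * t) - 24 * (s * t)\<bar> \<le> 576 * (t * Q)"
    using stQ(1) by linarith
  moreover have "t * (x / t - 24 * s) = x - 24 * (s * t)" for x
    using t by (simp add: field_simps)
  ultimately have "\<bar>t * ((phi24 (s * t * Q) - phi24 (s * t)) / t - 24 * s)\<bar> \<le> t * (576 * Q)"
    by (simp add: mult_ac)
  then have "\<bar>(phi24 (s * t * Q) - phi24 (s * t)) / t - 24 * s\<bar> \<le> 576 * Q"
    using t by (simp only: abs_mult abs_of_pos mult_le_cancel_left_pos)
  then show ?thesis by (simp add: t_def mult_ac)
qed

lemma phi24_near_one: "0 \<le> x \<Longrightarrow> x \<le> Q \<Longrightarrow> \<bar>phi24 x - 1\<bar> \<le> 25 * Q"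
proof -
  assume x: "0 \<le> x" "x \<le> Q"
  have "x\<^sup>2 \<le> 1 / 600 * Q"
    unfolding power2_eq_square using x Q by (intro mult_mono) auto
  with phi24_approx[of x] x Q show ?thesis by auto
qed

lemma den_coeff_approx: "\<bar>den_coeff k - fps_nth limit_denominator k\<bar> \<le> 576 * Q"
proof (cases "k = 0")
  case True
  then show ?thesis
    using phi24_near_one[of Q] Q by (simp add: den_coeff_def limit_denominator_def)
next
  case False
  then show ?thesis
    using phi24_difference[of 1 k] by (simp add: den_coeff_def limit_denominator_def)
qed

lemma den_coeff_bounds: "\<bar>den_coeff 0\<bar> \<ge> 1 / 2" "k > 0 \<Longrightarrow> \<bar>den_coeff k\<bar> \<le> 25"
  using phi24_near_one[of Q] den_coeff_approx[of k] Q by (auto simp: limit_denominator_def den_coeff_def)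

text \<open>For \<open>k >= 2\<close> the constant is \<open>601 = 576 + 25\<close>: 576 from
  \<open>phi24_difference\<close>, 25 from the subtracted denominator coefficient. As
  \<open>A >= 1\<close>, errors of size \<open>Q\<close> are absorbed into
  \<open>A * Q\<close>.\<close>

lemma num_coeff_approx: "\<bar>num_coeff k - fps_nth (limit_numerator q) k\<bar> \<le> 601 * A * Q"
proof -
  have AQ: "Q \<le> A * Q" using A Q by simp
  consider "k = 0" | "k = 1" | "k \<ge> 2" by linarith
  then show ?thesis
  proof cases
    case 1
    then show ?thesis using A Q by (simp add: num_coeff_def limit_numerator_def)
  next
    case 2
    have qQ: "0 \<le> q * Q" "q * Q \<le> Q" using q Q by auto
    have "\<bar>q * (phi24 (q * Q) - 1)\<bar> \<le> 1 * (25 * Q)"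
      unfolding abs_mult using phi24_near_one[OF qQ] q by (intro mult_mono) auto
    moreover have "Q\<^sup>2 \<le> Q"
      using Q_power_le(2)[of 1] by (simp only: numeral_2_eq_2 One_nat_def)
    then have "Q\<^sup>2 \<le> 1 / 2" using Q by linarith
    then have "0 \<le> A * Q * phi24 (Q\<^sup>2)" "A * Q * phi24 (Q\<^sup>2) \<le> A * Q * 1"
      using phi24_bounds[of "Q\<^sup>2"] A Q by (auto intro!: mult_left_mono)
    ultimately have "\<bar>q * phi24 (q * Q) - A * Q * phi24 (Q\<^sup>2) - q\<bar> \<le> 601 * (A * Q)"
      using AQ by (simp add: algebra_simps)
    then show ?thesis using 2 by (simp add: num_coeff_def limit_numerator_def)
  next
    case 3
    then obtain j where j: "k = Suc j" "j > 0" by (cases k) auto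
    define X where "X = (phi24 (q * Q ^ Suc j) - phi24 (q * Q ^ j)) / Q ^ j - 24 * q"
    have "\<bar>q * X\<bar> \<le> 1 * (576 * Q)"
      unfolding abs_mult X_def using phi24_difference[of q j] q j by (intro mult_mono) auto
    moreover have "\<bar>A * Q\<^sup>2 * den_coeff k\<bar> \<le> A * Q * 25"
    proof -
      have "\<bar>A * Q\<^sup>2 * den_coeff k\<bar> = A * Q * (Q * \<bar>den_coeff k\<bar>)"
        using A Q by (simp add: abs_mult power2_eq_square)
      also have "\<dots> \<le> A * Q * (1 * 25)"
        using A Q den_coeff_bounds(2)[of k] j by (intro mult_left_mono mult_mono) auto
      finally show ?thesis by simp
    qed
    ultimately have "\<bar>q * X - A * Q\<^sup>2 * den_coeff k\<bar> \<le> 601 * (A * Q)"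
      using AQ by linarith
    moreover have "num_coeff k - fps_nth (limit_numerator q) k = q * X - A * Q\<^sup>2 * den_coeff k"
      using j by (simp add: num_coeff_def limit_numerator_def X_def algebra_simps power2_eq_square)
    ultimately show ?thesis by simp
  qed
qed

lemma num_coeff_bound: "\<bar>num_coeff k\<bar> \<le> 26 * A"
proof -
  have "A * Q \<le> A * (1 / 600)" using A Q by (intro mult_left_mono) auto
  then have "601 * A * Q \<le> 2 * A" using A by simp
  moreover have "q\<^sup>2 \<le> 1" using q by (simp add: power_le_one)
  then have "\<bar>fps_nth (limit_numerator q) k\<bar> \<le> 24"
    using q by (auto simp: limit_numerator_def)
  ultimately show ?thesis
    using num_coeff_approx[of k] A by linarith
qed

text \<open>In the variable \<open>u = z Q^2\<close> these are the coefficients of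
  \<open>Q^2 (N z / D z - A)\<close>, because the factor \<open>1 - z Q\<close> cancels in the
  quotient.\<close>

definition quot_coeff :: "nat \<Rightarrow> real" where
  "quot_coeff = fps_nth (Abs_fps num_coeff / Abs_fps den_coeff)"

lemma quot_coeff_mult: "Abs_fps quot_coeff * Abs_fps den_coeff = Abs_fps num_coeff"
proof -
  have "fps_nth (Abs_fps den_coeff) 0 \<noteq> 0"
    using den_coeff_bounds(1) by auto
  then have "(Abs_fps num_coeff / Abs_fps den_coeff) * Abs_fps den_coeff = Abs_fps num_coeff"
    by (simp add: fps_divide_unit mult.assoc inverse_mult_eq_1)
  then show ?thesis by (simp add: quot_coeff_def fps_nth_inverse)
qed

lemma quot_coeff_0: "quot_coeff 0 = 0"
  using arg_cong[OF quot_coeff_mult, of "\<lambda>f. fps_nth f 0"] den_coeff_bounds(1)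
  by (auto simp: num_coeff_def)

lemma quot_coeff_bound: "\<bar>quot_coeff k\<bar> \<le> 52 * A * 51 ^ k"
  using fps_quotient_nth_bound[OF quot_coeff_mult, of k "26 * A"] den_coeff_bounds num_coeff_bound
  by simp

lemma quot_coeff_approx:
  "\<bar>quot_coeff k - fps_nth (limit_quotient q) k\<bar>
     \<le> 2 * (601 + real (Suc k) * (24 * 23 ^ k) * 576) * 51 ^ k * (A * Q)"
proof -
  have "\<bar>quot_coeff k - fps_nth (limit_quotient q) k\<bar>
      \<le> 2 * (601 * A * Q + real (Suc k) * (24 * 23 ^ k) * (576 * Q)) * 51 ^ k"
    using limit_quotient_perturbation[OF quot_coeff_mult, of q "576 * Q" "601 * A * Q" k]
      q Q den_coeff_bounds den_coeff_approx num_coeff_approx by simp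
  also have "\<dots> \<le> 2 * (601 * (A * Q) + real (Suc k) * (24 * 23 ^ k) * (576 * (A * Q))) * 51 ^ k"
    using A Q by (intro mult_right_mono mult_left_mono add_mono) (auto simp del: of_nat_Suc)
  also have "\<dots> = 2 * (601 + real (Suc k) * (24 * 23 ^ k) * 576) * 51 ^ k * (A * Q)"
    by (simp only: distrib_left distrib_right mult.assoc mult.left_commute mult.commute)
  finally show ?thesis .
qed

section \<open>Convergence on the unit circle\<close>

lemma weighted_Q_power_le:
  assumes "\<bar>x\<bar> \<le> M * 51 ^ k" and "norm z = 1"
  shows "norm (complex_of_real (x * Q ^ (2 * k)) * z ^ k) \<le> M * (1 / 600) ^ k"
proof -
  \<comment> \<open>The factor \<open>Q^2\<close> hidden in \<open>u\<close> beats the growth rate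
    51 of the coefficients.\<close>
  have "51 * Q\<^sup>2 \<le> 51 * (1 / 600)\<^sup>2"
    using Q by (intro mult_left_mono power_mono) auto
  then have "51 * Q\<^sup>2 \<le> 1 / 600" by (simp add: power2_eq_square)
  then have pow: "(51 * Q\<^sup>2) ^ k \<le> (1 / 600) ^ k"
    by (intro power_mono) auto
  have "0 * 51 ^ k \<le> M * 51 ^ k" using assms(1) by simp
  then have M: "0 \<le> M" by (rule mult_right_le_imp_le) simp
  have "norm (complex_of_real (x * Q ^ (2 * k)) * z ^ k) = \<bar>x\<bar> * Q ^ (2 * k)"
    using assms(2) Q by (simp add: norm_mult norm_power abs_mult)
  also have "\<dots> \<le> M * 51 ^ k * Q ^ (2 * k)"
    using assms(1) Q by (intro mult_right_mono) auto
  also have "\<dots> = M * (51 * Q\<^sup>2) ^ k"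
    by (simp add: power_mult power_mult_distrib)
  also have "\<dots> \<le> M * (1 / 600) ^ k"
    using pow M by (intro mult_left_mono)
  finally show ?thesis .
qed

lemma summable_weighted:
  fixes x :: "nat \<Rightarrow> real"
  assumes "\<And>k. \<bar>x k\<bar> \<le> M * 51 ^ k" and "norm z = 1"
  shows "summable (\<lambda>k. norm (complex_of_real (x k * Q ^ (2 * k)) * z ^ k))"
proof (rule summable_comparison_test')
  show "summable (\<lambda>k. M * (1 / 600) ^ k)"
    by (intro summable_mult summable_geometric) simp
  show "norm (norm (complex_of_real (x k * Q ^ (2 * k)) * z ^ k)) \<le> M * (1 / 600) ^ k" for k
    using weighted_Q_power_le[OF assms] by simp
qed

lemma den_coeff_le: "\<bar>den_coeff k\<bar> \<le> 25 * 51 ^ k"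
proof -
  have "\<bar>den_coeff k\<bar> \<le> 25"
    using den_coeff_bounds(2)[of k] phi24_bounds[of Q] Q by (cases "k = 0") (auto simp: den_coeff_def)
  also have "\<dots> \<le> 25 * 51 ^ k" by simp
  finally show ?thesis .
qed

text \<open>The constant coefficient is at least 1/2 in absolute value, while the other terms sum to
  at most \<open>25 / 599\<close>.\<close>

lemma den_series_nonzero:
  assumes "norm z = 1"
  shows "(\<Sum>k. complex_of_real (den_coeff k * Q ^ (2 * k)) * z ^ k) \<noteq> 0"
proof
  let ?t = "\<lambda>k. complex_of_real (den_coeff k * Q ^ (2 * k)) * z ^ k"
  assume 0: "suminf ?t = 0"
  have "summable ?t"
    using summable_weighted[OF den_coeff_le assms] by (rule summable_norm_cancel)
  from suminf_split_head[OF this] 0 have eq: "(\<Sum>k. ?t (Suc k)) = - of_real (den_coeff 0)"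
    by simp
  have geo: "(\<lambda>k. 25 * (1 / 600) ^ Suc k) sums (25 * (1 / 600) * (1 / (1 - 1 / 600 :: real)))"
    using sums_mult[OF geometric_sums[of "1 / 600 :: real"], of "25 * (1 / 600)"] by (simp add: mult_ac)
  have "norm (\<Sum>k. ?t (Suc k)) \<le> (\<Sum>k. 25 * (1 / 600) ^ Suc k)"
    by (rule norm_suminf_le[OF weighted_Q_power_le[OF den_coeff_le assms] sums_summable[OF geo]])
  also have "\<dots> < 1 / 2"
    using geo by (simp add: sums_iff)
  finally have "\<bar>den_coeff 0\<bar> < 1 / 2"
    unfolding eq by simp
  with den_coeff_bounds(1) show False by simp
qed

text \<open>Multiplication by \<open>1 - z Q\<close> turns \<open>D\<close> and
  \<open>N - A D\<close> into series in \<open>u\<close> with the coefficients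
  \<open>den_coeff\<close> and \<open>num_coeff\<close>. The formal quotient then becomes an
  identity of convergent series.\<close>

lemma quotient_series:
  fixes z :: complex
  assumes inv: "q * phi24 q = A * (Q * phi24 Q)" and z: "norm z = 1"
  shows "(\<Sum>m. z ^ m * of_real (q * Q ^ m * phi24 (q * Q ^ m))) / (\<Sum>m. z ^ m * of_real (Q ^ Suc m * phi24 (Q ^ Suc m)))
           = of_real A + (\<Sum>k. of_real (quot_coeff k * Q ^ (2 * k) / Q\<^sup>2) * z ^ k)"
proof -
  define f where "f m = Q ^ Suc m * phi24 (Q ^ Suc m)" for m
  define h where "h m = q * Q ^ m * phi24 (q * Q ^ m)" for m
  define g where "g m = h m - A * f m" for m
  \<comment> \<open>The inversion makes the constant term of \<open>N - A D\<close> vanish, in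
    agreement with \<open>num_coeff 0 = 0\<close>.\<close>
  have g0: "g 0 = 0" using inv by (simp add: g_def h_def f_def)
  define SD where "SD = (\<Sum>m. z ^ m * of_real (f m))"
  define SN where "SN = (\<Sum>m. z ^ m * of_real (h m))"
  have geo: "summable (\<lambda>m. Q ^ m)" using Q by (intro summable_geometric) auto
  have "norm (z ^ m * of_real (f m)) \<le> Q ^ m" for m
  proof -
    have "0 \<le> Q ^ Suc m" "Q ^ Suc m \<le> 1 / 2"
      using Q_power_le(2)[of m] Q by (simp_all del: power_Suc)
    note bounds = phi24_bounds[OF this]
    have "norm (z ^ m * of_real (f m)) = Q ^ Suc m * phi24 (Q ^ Suc m)"
      using z Q bounds by (simp add: norm_mult norm_power f_def abs_mult del: power_Suc)
    also have "\<dots> \<le> Q ^ m * 1"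
      using bounds Q by (intro mult_mono power_decreasing) (auto simp del: power_Suc)
    finally show ?thesis by simp
  qed
  then have "summable (\<lambda>m. z ^ m * of_real (f m))"
    by (intro summable_comparison_test'[OF geo]) auto
  then have SD: "(\<lambda>m. z ^ m * of_real (f m)) sums SD"
    unfolding SD_def by (rule summable_sums)
  \<comment> \<open>The index 0 is left out because \<open>q\<close> may exceed 1/2, outside the
    range of \<open>phi24_bounds\<close>; summability does not depend on it.\<close>
  have "norm (z ^ m * of_real (h m)) \<le> Q ^ m" if "m \<ge> 1" for m
  proof -
    have qQ: "0 \<le> q * Q ^ m" "q * Q ^ m \<le> Q ^ m"
      using q Q_power_le(1)[of m] by (auto simp: mult_le_cancel_right1)
    have "Q ^ m \<le> Q" using Q_power_le(2)[of "m - 1"] that by simp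
    then have half: "q * Q ^ m \<le> 1 / 2" using qQ Q by linarith
    have "norm (z ^ m * of_real (h m)) = q * Q ^ m * phi24 (q * Q ^ m)"
      using z q Q qQ phi24_bounds[OF qQ(1) half] by (simp add: norm_mult norm_power h_def abs_mult)
    also have "\<dots> \<le> Q ^ m * 1"
      using qQ phi24_bounds[OF qQ(1) half] by (intro mult_mono) auto
    finally show ?thesis by simp
  qed
  then have "summable (\<lambda>m. z ^ m * of_real (h m))"
    by (intro summable_comparison_test'[OF geo]) auto
  then have SN: "(\<lambda>m. z ^ m * of_real (h m)) sums SN"
    unfolding SN_def by (rule summable_sums)
  have SG: "(\<lambda>m. z ^ m * of_real (g m)) sums (SN - of_real A * SD)"
    using sums_diff[OF SN sums_mult[OF SD, of "of_real A"]]
    by (simp add: g_def algebra_simps)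

  define E where "E = (\<Sum>k. complex_of_real (den_coeff k * Q ^ (2 * k)) * z ^ k)"
  define X where "X = (\<Sum>k. complex_of_real (num_coeff k * Q ^ (2 * k)) * z ^ k)"
  define Y where "Y = (\<Sum>k. complex_of_real (quot_coeff k * Q ^ (2 * k)) * z ^ k)"
  have num: "\<bar>num_coeff k\<bar> \<le> 26 * A * 51 ^ k" for k
  proof -
    have "26 * A * 1 \<le> 26 * A * 51 ^ k" using A by (intro mult_left_mono) auto
    then show ?thesis using num_coeff_bound[of k] by linarith
  qed
  note sumE = summable_weighted[OF den_coeff_le z]
  note sumX = summable_weighted[OF num z]
  note sumY = summable_weighted[OF quot_coeff_bound z]

  have den: "Q * (den_coeff k * Q ^ (2 * k)) = f k - (if k = 0 then 0 else Q * f (k - 1))" for k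
    using Q by (cases k) (simp_all add: den_coeff_def f_def field_simps power2_eq_square power_mult power_mult_distrib)
  have nu: "num_coeff k * Q ^ (2 * k) = Q * (g k - (if k = 0 then 0 else Q * g (k - 1)))" for k
  proof -
    consider "k = 0" | "k = 1" | j where "k = Suc (Suc j)"
      by (metis One_nat_def not0_implies_Suc)
    then show ?thesis
    proof cases
      case 1
      then show ?thesis using g0 by (simp add: num_coeff_def)
    next
      case 2
      then show ?thesis using g0
        by (simp add: num_coeff_def) (simp add: g_def h_def f_def algebra_simps power2_eq_square)
    next
      case 3
      let ?D = "phi24 (q * Q ^ k) - phi24 (q * Q ^ (k - 1))"
      have "Q ^ (2 * k) = Q ^ (k - 1) * Q ^ Suc k"
      proof -
        have "2 * k = (k - 1) + Suc k" using 3 by simp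
        then show ?thesis by (metis power_add)
      qed
      then have "q * (?D / Q ^ (k - 1)) * Q ^ (2 * k) = q * ?D * Q ^ Suc k"
        using Q by simp
      moreover have "A * Q\<^sup>2 * den_coeff k * Q ^ (2 * k) = A * Q * (f k - Q * f (k - 1))"
        using den[of k] 3 by (simp add: power2_eq_square mult_ac)
      moreover have "Q * (h k - Q * h (k - 1)) = q * ?D * Q ^ Suc k"
        using 3 by (simp add: h_def algebra_simps)
      ultimately show ?thesis
        using 3 by (simp add: num_coeff_def g_def left_diff_distrib right_diff_distrib mult_ac)
    qed
  qed
  have shift: "(if k = 0 then 0 else z * of_real Q * (z ^ (k - 1) * of_real (u (k - 1))))
      = z ^ k * of_real (if k = 0 then 0 else Q * u (k - 1))" for k and u :: "nat \<Rightarrow> real"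
    by (cases k) auto
  have "(\<lambda>k. of_real Q * (complex_of_real (den_coeff k * Q ^ (2 * k)) * z ^ k)) sums ((1 - z * of_real Q) * SD)"
  proof -
    have "of_real Q * (complex_of_real (den_coeff k * Q ^ (2 * k)) * z ^ k)
        = z ^ k * of_real (f k) - (if k = 0 then 0 else z * of_real Q * (z ^ (k - 1) * of_real (f (k - 1))))" for k
    proof -
      have "of_real Q * (complex_of_real (den_coeff k * Q ^ (2 * k)) * z ^ k)
          = z ^ k * of_real (Q * (den_coeff k * Q ^ (2 * k)))"
        by (simp only: of_real_mult mult_ac)
      then show ?thesis
        unfolding den shift by (simp only: of_real_diff right_diff_distrib)
    qed
    then show ?thesis
      using sums_times_one_minus[OF SD, of "z * of_real Q"] by (simp only:)
  qed
  then have D: "(1 - z * of_real Q) * SD = of_real Q * E"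
    using sums_mult[OF summable_sums[OF summable_norm_cancel[OF sumE]], of "of_real Q"]
    unfolding E_def by (rule sums_unique2)
  have "(\<lambda>k. complex_of_real (num_coeff k * Q ^ (2 * k)) * z ^ k) sums (of_real Q * ((1 - z * of_real Q) * (SN - of_real A * SD)))"
  proof -
    have "complex_of_real (num_coeff k * Q ^ (2 * k)) * z ^ k
        = of_real Q * (z ^ k * of_real (g k) - (if k = 0 then 0 else z * of_real Q * (z ^ (k - 1) * of_real (g (k - 1)))))" for k
      unfolding shift nu by (simp only: of_real_mult of_real_diff right_diff_distrib left_diff_distrib mult_ac)
    then show ?thesis
      using sums_mult[OF sums_times_one_minus[OF SG, of "z * of_real Q"], of "of_real Q"] by (simp only:)
  qed
  then have N: "of_real Q * ((1 - z * of_real Q) * (SN - of_real A * SD)) = X"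
    unfolding X_def by (rule sums_unique)
  \<comment> \<open>The Cauchy product of the absolutely convergent series \<open>Y\<close> and
    \<open>E\<close> has the coefficients of the formal product, which
    \<open>quot_coeff_mult\<close> identifies.\<close>
  have "X = Y * E"
  proof -
    have "(\<lambda>k. \<Sum>i\<le>k. (complex_of_real (quot_coeff i * Q ^ (2 * i)) * z ^ i) *
            (complex_of_real (den_coeff (k - i) * Q ^ (2 * (k - i))) * z ^ (k - i))) sums (Y * E)"
      unfolding Y_def E_def by (rule Cauchy_product_sums[OF sumY sumE])
    moreover have "(\<Sum>i\<le>k. (complex_of_real (quot_coeff i * Q ^ (2 * i)) * z ^ i) *
            (complex_of_real (den_coeff (k - i) * Q ^ (2 * (k - i))) * z ^ (k - i)))
        = complex_of_real (num_coeff k * Q ^ (2 * k)) * z ^ k" for k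
    proof -
      have "(complex_of_real (quot_coeff i * Q ^ (2 * i)) * z ^ i) *
            (complex_of_real (den_coeff (k - i) * Q ^ (2 * (k - i))) * z ^ (k - i))
          = of_real (quot_coeff i * den_coeff (k - i)) * (of_real (Q ^ (2 * k)) * z ^ k)" if "i \<le> k" for i
      proof -
        have "Q ^ (2 * k) = Q ^ (2 * i) * Q ^ (2 * (k - i))" "z ^ k = z ^ i * z ^ (k - i)"
          using that by (simp_all flip: power_add add: diff_mult_distrib2)
        then show ?thesis by (simp only: of_real_mult mult_ac)
      qed
      then have "(\<Sum>i\<le>k. (complex_of_real (quot_coeff i * Q ^ (2 * i)) * z ^ i) *
            (complex_of_real (den_coeff (k - i) * Q ^ (2 * (k - i))) * z ^ (k - i)))
          = (\<Sum>i\<le>k. of_real (quot_coeff i * den_coeff (k - i)) * (of_real (Q ^ (2 * k)) * z ^ k))"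
        by (intro sum.cong) auto
      also have "\<dots> = of_real (\<Sum>i\<le>k. quot_coeff i * den_coeff (k - i)) * (of_real (Q ^ (2 * k)) * z ^ k)"
        by (simp add: sum_distrib_right)
      also have "(\<Sum>i\<le>k. quot_coeff i * den_coeff (k - i)) = num_coeff k"
        using arg_cong[OF quot_coeff_mult, of "\<lambda>f. fps_nth f k"] by (simp add: fps_mult_nth atLeast0AtMost)
      finally show ?thesis by simp
    qed
    ultimately have "(\<lambda>k. complex_of_real (num_coeff k * Q ^ (2 * k)) * z ^ k) sums (Y * E)"
      by (simp only:)
    then show ?thesis unfolding X_def by (rule sums_unique[symmetric])
  qed
  have nz: "E \<noteq> 0" "complex_of_real Q \<noteq> 0"
    using den_series_nonzero[OF z] Q by (auto simp: E_def)
  have zQ: "1 - z * of_real Q \<noteq> 0"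
  proof
    assume "1 - z * of_real Q = 0"
    then have "norm (z * of_real Q) = 1" by (metis eq_iff_diff_eq_0 norm_one)
    then show False using z Q by (simp add: norm_mult)
  qed
  have "SD \<noteq> 0" using D nz by auto
  \<comment> \<open>Eliminate \<open>E\<close> by means of \<open>D\<close>, then cancel
    \<open>1 - z Q\<close>, which is nonzero since \<open>|z Q| = Q < 1\<close>.\<close>
  have "of_real Q * ((1 - z * of_real Q) * (SN - of_real A * SD)) = Y * E"
    using N \<open>X = Y * E\<close> by simp
  then have "of_real Q * of_real Q * ((1 - z * of_real Q) * (SN - of_real A * SD)) = Y * ((1 - z * of_real Q) * SD)"
    using D by (simp add: mult_ac)
  then have "(1 - z * of_real Q) * (of_real Q * of_real Q * (SN - of_real A * SD)) = (1 - z * of_real Q) * (Y * SD)"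
    by (simp only: mult_ac)
  then have "of_real Q * of_real Q * (SN - of_real A * SD) = Y * SD"
    using zQ by (simp only: mult_cancel_left simp_thms)
  then have "SN / SD = of_real A + Y / (of_real Q)\<^sup>2"
    using \<open>SD \<noteq> 0\<close> nz by (simp add: field_simps power2_eq_square)
  also have "Y / (of_real Q)\<^sup>2 = (\<Sum>k. of_real (quot_coeff k * Q ^ (2 * k) / Q\<^sup>2) * z ^ k)"
    unfolding Y_def
    by (subst suminf_divide[symmetric, OF summable_norm_cancel[OF sumY]]) simp
  finally show ?thesis by (simp only: SN_def SD_def h_def f_def)
qed

text \<open>The averaging isolates the coefficient of \<open>z ^ d\<close>, which is
  \<open>quot_coeff d * Q ^ (2 * d - 2)\<close>. Replacing \<open>quot_coeff d\<close> by its limit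
  costs a multiple of \<open>A * Q\<close>, and the later indices are of order
  \<open>A * Q ^ (2 * d)\<close>. The constant depends on \<open>d\<close> alone.\<close>

lemma average_estimate:
  assumes inv: "q * phi24 q = A * (Q * phi24 Q)" and d: "d \<ge> 2"
  shows "norm (1 / of_nat d * (\<Sum>z::complex | z ^ d = 1.
             (\<Sum>m. z ^ m * of_real (q * Q ^ m * phi24 (q * Q ^ m))) / (\<Sum>m. z ^ m * of_real (Q ^ Suc m * phi24 (Q ^ Suc m))))
           - of_real A - of_real (24 * q * (q - 1) * (- 23) ^ (d - 2) * Q ^ (2 * d - 2)))
         \<le> (2 * (601 + real (Suc d) * (24 * 23 ^ d) * 576) * 51 ^ d + 104 * 51 ^ Suc d) * (A * Q ^ (2 * d - 1))"
proof -
  define c where "c k = quot_coeff k * Q ^ (2 * k) / Q\<^sup>2" for k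
  define r where "r = 51 * Q\<^sup>2"
  define C where "C = 2 * (601 + real (Suc d) * (24 * 23 ^ d) * 576) * 51 ^ d"
  let ?U = "{z::complex. z ^ d = 1}"
  have U: "finite ?U" "card ?U = d"
    using d finite_roots_unity[of d] card_roots_unity_eq[of d] by auto
  have "Q\<^sup>2 \<le> (1 / 600)\<^sup>2" using Q by (intro power_mono) auto
  then have r: "0 \<le> r" "r \<le> 1 / 2" by (auto simp: r_def power2_eq_square)
  have c_le: "\<bar>c k\<bar> \<le> 52 * A / Q\<^sup>2 * r ^ k" for k
  proof -
    have "\<bar>c k\<bar> = \<bar>quot_coeff k\<bar> * (Q ^ (2 * k) / Q\<^sup>2)"
      using Q by (simp add: c_def abs_mult)
    also have "\<dots> \<le> 52 * A * 51 ^ k * (Q ^ (2 * k) / Q\<^sup>2)"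
      using Q by (intro mult_right_mono quot_coeff_bound) auto
    also have "\<dots> = 52 * A / Q\<^sup>2 * (51 ^ k * Q ^ (2 * k))"
      by simp
    also have "51 ^ k * Q ^ (2 * k) = r ^ k"
      by (simp only: r_def power_mult_distrib power_mult)
    finally show ?thesis .
  qed
  have "(\<Sum>z\<in>?U. (\<Sum>m. z ^ m * of_real (q * Q ^ m * phi24 (q * Q ^ m))) / (\<Sum>m. z ^ m * of_real (Q ^ Suc m * phi24 (Q ^ Suc m))))
      = (\<Sum>z\<in>?U. of_real A + (\<Sum>k. of_real (c k) * z ^ k))"
  proof (rule sum.cong)
    fix z :: complex assume "z \<in> ?U"
    then have "norm z = 1" using d power_eq_1_iff[of z d] by simp
    then show "(\<Sum>m. z ^ m * of_real (q * Q ^ m * phi24 (q * Q ^ m))) / (\<Sum>m. z ^ m * of_real (Q ^ Suc m * phi24 (Q ^ Suc m)))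
        = of_real A + (\<Sum>k. of_real (c k) * z ^ k)"
      unfolding c_def by (rule quotient_series[OF inv])
  qed simp
  also have "1 / of_nat d * \<dots> = of_real A + 1 / of_nat d * (\<Sum>z\<in>?U. \<Sum>k. of_real (c k) * z ^ k)"
    using U d by (simp add: sum.distrib field_simps)
  finally have W: "1 / of_nat d * (\<Sum>z\<in>?U. (\<Sum>m. z ^ m * of_real (q * Q ^ m * phi24 (q * Q ^ m))) / (\<Sum>m. z ^ m * of_real (Q ^ Suc m * phi24 (Q ^ Suc m))))
      = of_real A + 1 / of_nat d * (\<Sum>z\<in>?U. \<Sum>k. of_real (c k) * z ^ k)" (is "?W = _") .
  define T where "T = 24 * q * (q - 1) * (- 23) ^ (d - 2) * Q ^ (2 * d - 2)"
  have Q2: "Q ^ (2 * d) = Q ^ (2 * d - 2) * Q\<^sup>2" "Q ^ (2 * d - 1) = Q ^ (2 * d - 2) * Q"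
  proof -
    have "2 * d = (2 * d - 2) + 2" "2 * d - 1 = (2 * d - 2) + 1" using d by simp_all
    then show "Q ^ (2 * d) = Q ^ (2 * d - 2) * Q\<^sup>2" "Q ^ (2 * d - 1) = Q ^ (2 * d - 2) * Q"
      by (metis power_add, metis power_add power_one_right)
  qed
  \<comment> \<open>As \<open>d >= 2\<close>, the third branch of \<open>limit_quotient\<close>
    applies, and this is exactly the main term.\<close>
  have "c d - T = (quot_coeff d - fps_nth (limit_quotient q) d) * Q ^ (2 * d - 2)"
    using d Q by (simp add: c_def T_def limit_quotient_def Q2 left_diff_distrib)
  then have "\<bar>c d - T\<bar> \<le> C * (A * Q) * Q ^ (2 * d - 2)"
    unfolding C_def using A Q by (simp only: abs_mult) (intro mult_mono quot_coeff_approx, auto)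
  then have cT: "\<bar>c d - T\<bar> \<le> C * (A * Q ^ (2 * d - 1))"
    unfolding Q2(2) by (simp only: mult_ac)
  have "norm (1 / of_nat d * (\<Sum>z\<in>?U. \<Sum>k. of_real (c k) * z ^ k) - of_real (c d)) \<le> 2 * (52 * A / Q\<^sup>2) * r ^ Suc d"
    using d r c_le by (intro roots_of_unity_filter_bound) (auto simp: c_def quot_coeff_0)
  also have "\<dots> = 104 * 51 ^ Suc d * (A * Q ^ (2 * d))"
  proof -
    have "r ^ Suc d = 51 ^ Suc d * (Q ^ (2 * d) * Q\<^sup>2)"
      by (simp add: r_def power_mult_distrib power_mult)
    then show ?thesis using Q by (simp del: power_Suc)
  qed
  also have "\<dots> \<le> 104 * 51 ^ Suc d * (A * Q ^ (2 * d - 1))"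
    using A Q by (intro mult_left_mono power_decreasing) auto
  finally have tail: "norm (1 / of_nat d * (\<Sum>z\<in>?U. \<Sum>k. of_real (c k) * z ^ k) - of_real (c d))
      \<le> 104 * 51 ^ Suc d * (A * Q ^ (2 * d - 1))" .
  have "?W - of_real A - of_real T
      = (1 / of_nat d * (\<Sum>z\<in>?U. \<Sum>k. of_real (c k) * z ^ k) - of_real (c d)) + of_real (c d - T)"
    unfolding W by simp
  also have "norm \<dots> \<le> 104 * 51 ^ Suc d * (A * Q ^ (2 * d - 1)) + C * (A * Q ^ (2 * d - 1))"
    by (intro norm_triangle_mono tail) (simp only: norm_of_real cT)
  also have "\<dots> = (C + 104 * 51 ^ Suc d) * (A * Q ^ (2 * d - 1))"
    by (simp only: distrib_right add.commute)
  finally show ?thesis by (simp only: T_def C_def)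
qed

end

section \<open>Asymptotics\<close>

text \<open>Since \<open>q^(a m + 1) = q Q^m\<close> and \<open>q^(a (m + 1)) = Q^(m + 1)\<close>,
  every argument of \<open>Phi\<close> is real and lies in \<open>[0, 1)\<close>.\<close>

lemma W24_eq_average:
  assumes "0 < nome a" "nome a < 1" "Nome a < 1"
  shows "W24 a d (of_real (nome a)) = 1 / of_nat d * (\<Sum>z::complex | z ^ d = 1.
           (\<Sum>m. z ^ m * of_real (nome a * Nome a ^ m * phi24 (nome a * Nome a ^ m)))
           / (\<Sum>m. z ^ m * of_real (Nome a ^ Suc m * phi24 (Nome a ^ Suc m))))"
proof -
  have Nome: "0 < Nome a" using assms by (simp add: Nome_def)
  have "0 \<le> nome a * Nome a ^ m" "nome a * Nome a ^ m < 1" for m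
    using mult_le_less_imp_less[of "Nome a ^ m" 1 "nome a" 1] assms Nome by (auto simp: power_le_one mult_ac)
  moreover have "0 \<le> Nome a ^ Suc m" "Nome a ^ Suc m < 1" for m
    using assms Nome by (auto simp: power_Suc_less_one simp del: power_Suc)
  moreover have "nome a ^ (a * m + 1) = nome a * Nome a ^ m" "nome a ^ (a * (m + 1)) = Nome a ^ Suc m" for m
    by (simp_all add: Nome_def flip: power_mult) (simp add: power_add)
  ultimately show ?thesis
    unfolding W24_def
    by (simp add: Phi_of_real phi24_def mult.assoc del: power_Suc flip: of_real_power of_real_mult)
qed

theorem proposition6p2:
  fixes d :: nat
  assumes "d \<ge> 2"
  shows "(\<lambda>a::nat. (W24 a d (of_real (nome a)) - of_nat a ^ 6)
            - of_real (24 * nome a * (nome a - 1) * (- 23) ^ (d - 2) * Nome a ^ (2 * d - 2)))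
         \<in> O(\<lambda>a. of_real (real a ^ 6 * Nome a ^ (2 * d - 1)))
       \<and> (\<lambda>a::nat. W24 a d (of_real (nome a)) - of_nat a ^ 6)
         \<sim>[at_top]
         (\<lambda>a. of_real (48 * pi * (- 1) ^ (d - 1) * 23 ^ (d - 2) * real a powr (- 1 / 2)
                       * exp (- 4 * pi * (real d - 1) * sqrt (real a))))"
proof
  define W where "W a = W24 a d (of_real (nome a)) - of_nat a ^ 6" for a
  define T where "T a = 24 * nome a * (nome a - 1) * (- 23) ^ (d - 2) * Nome a ^ (2 * d - 2)" for a
  define S where "S a = 48 * pi * (- 1) ^ (d - 1) * 23 ^ (d - 2) * real a powr (- 1 / 2)
                       * exp (- 4 * pi * (real d - 1) * sqrt (real a))" for a :: nat
  define H where "H a = real a ^ 6 * Nome a ^ (2 * d - 1)" for a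
  \<comment> \<open>\<open>Nome a\<close> tends to 0, so the assumptions of
    \<open>eta_quotient\<close> hold for all large \<open>a\<close>.\<close>
  have "filterlim (\<lambda>a::nat. exp (- 2 * pi * sqrt (real a))) (nhds 0) at_top"
    by real_asymp
  then have "eventually (\<lambda>a. Nome a < 1 / 600) at_top"
    unfolding Nome_eq by (rule order_tendstoD) simp
  then have "eventually (\<lambda>a. norm (W a - of_real (T a))
      \<le> (2 * (601 + real (Suc d) * (24 * 23 ^ d) * 576) * 51 ^ d + 104 * 51 ^ Suc d) * norm (of_real (H a) :: complex)) at_top"
    using eventually_gt_at_top[of 0]
  proof eventually_elim
    case (elim a)
    have q: "0 < nome a" "nome a < 1" using elim(2) by (auto simp: nome_def)
    then have Q: "0 < Nome a" by (simp add: Nome_def)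
    interpret eta_quotient "nome a" "Nome a" "real a ^ 6"
      using q Q elim by unfold_locales auto
    have "nome a * phi24 (nome a) = real a ^ 6 * (Nome a * phi24 (Nome a))"
      unfolding phi24_def by (rule Delta_nome[OF elim(2)])
    from average_estimate[OF this assms]
    moreover have "norm (complex_of_real (H a)) = H a"
      unfolding norm_of_real using Q by (simp add: H_def)
    ultimately show ?case
      using q Q elim by (simp add: W_def T_def H_def W24_eq_average del: power_Suc of_nat_Suc)
  qed
  then have O: "(\<lambda>a. W a - of_real (T a)) \<in> O(\<lambda>a. of_real (H a))"
    by (rule bigoI)
  then show "(\<lambda>a::nat. (W24 a d (of_real (nome a)) - of_nat a ^ 6)
            - of_real (24 * nome a * (nome a - 1) * (- 23) ^ (d - 2) * Nome a ^ (2 * d - 2)))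
         \<in> O(\<lambda>a. of_real (real a ^ 6 * Nome a ^ (2 * d - 1)))"
    by (simp only: W_def T_def H_def)

  \<comment> \<open>\<open>K\<close> is the factor depending on \<open>d\<close>, common to
    \<open>T\<close> and \<open>S\<close>. Once it is split off, only fixed functions of
    \<open>a\<close> remain to be compared.\<close>
  define K where "K a = (- 23) ^ (d - 2) * Nome a ^ (2 * d - 2)" for a
  have S: "S a = (- 48 * pi * real a powr (- 1 / 2)) * K a" for a
  proof -
    have "real (2 * d - 2) = 2 * (real d - 1)" using assms by (simp add: of_nat_diff)
    then have "Nome a ^ (2 * d - 2) = exp (- 4 * pi * (real d - 1) * sqrt (real a))"
      unfolding Nome_eq exp_of_nat_mult[symmetric] by (simp add: mult_ac)
    moreover have "(- 1 :: real) ^ (d - 1) * 23 ^ (d - 2) = - ((- 23) ^ (d - 2))"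
    proof -
      have "d - 1 = Suc (d - 2)" using assms by simp
      then show ?thesis using power_mult_distrib[of "- 1 :: real" 23 "d - 2"] by simp
    qed
    moreover have "S a = 48 * pi * real a powr (- 1 / 2) * ((- 1) ^ (d - 1) * 23 ^ (d - 2))
        * exp (- 4 * pi * (real d - 1) * sqrt (real a))"
      by (simp only: S_def mult_ac)
    ultimately show ?thesis by (simp add: K_def)
  qed
  then have S_eq: "S = (\<lambda>a. - 48 * pi * real a powr (- 1 / 2) * K a)"
    by (rule ext)
  \<comment> \<open>Here \<open>nome a\<close> tends to 1 and \<open>1 - nome a\<close> is
    asymptotic to \<open>2 * pi / sqrt a\<close>, whence the constant
    \<open>-48 * pi\<close>.\<close>
  have "T \<sim>[at_top] S"
  proof -
    have "(\<lambda>a. 24 * nome a * (nome a - 1)) \<sim>[at_top] (\<lambda>a. - 48 * pi * real a powr (- 1 / 2))"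
      unfolding nome_def by real_asymp
    then have "(\<lambda>a. 24 * nome a * (nome a - 1) * K a) \<sim>[at_top] (\<lambda>a. - 48 * pi * real a powr (- 1 / 2) * K a)"
      by (rule asymp_equiv_mult) (rule asymp_equiv_refl)
    moreover have "T = (\<lambda>a. 24 * nome a * (nome a - 1) * K a)"
      by (simp add: fun_eq_iff T_def K_def mult.assoc)
    ultimately show ?thesis by (simp only: S_eq)
  qed
  then have TS: "(\<lambda>a. T a - S a) \<in> o(S)"
    by (rule asymp_equiv_imp_diff_smallo)
  \<comment> \<open>Relative to \<open>S\<close>, the error carries one more factor
    \<open>Nome a\<close>, whose exponential decay outweighs \<open>a ^ 6\<close> and the power
    \<open>a ^ (1/2)\<close>.\<close>
  have HS: "H \<in> o(S)"
  proof -
    have "(\<lambda>a. real a ^ 6 * Nome a) \<in> o(\<lambda>a. - 48 * pi * real a powr (- 1 / 2))"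
      unfolding Nome_eq by real_asymp
    moreover have "(\<lambda>a. Nome a ^ (2 * d - 2)) \<in> O(K)"
      by (simp add: K_def[abs_def])
    ultimately have "(\<lambda>a. real a ^ 6 * Nome a * Nome a ^ (2 * d - 2)) \<in> o(\<lambda>a. - 48 * pi * real a powr (- 1 / 2) * K a)"
      by (rule landau_o.small_big_mult)
    moreover have "2 * d - 1 = Suc (2 * d - 2)" using assms by simp
    then have "H = (\<lambda>a. real a ^ 6 * Nome a * Nome a ^ (2 * d - 2))"
      by (simp add: fun_eq_iff H_def mult.assoc)
    ultimately show ?thesis by (simp only: S_eq)
  qed
  have of_real: "(\<lambda>a. complex_of_real (f a)) \<in> o(\<lambda>a. complex_of_real (g a))" if "f \<in> o(g)" for f g :: "nat \<Rightarrow> real"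
    using that by (subst landau_o.small.norm_iff[symmetric]) simp
  have "(\<lambda>a. (W a - of_real (T a)) + of_real (T a - S a)) \<in> o(\<lambda>a. of_real (S a))"
    by (intro sum_in_smallo landau_o.big_small_trans[OF O] of_real HS TS)
  then have "(\<lambda>a. W a - of_real (S a)) \<in> o(\<lambda>a. of_real (S a))"
    by simp
  then have "W \<sim>[at_top] (\<lambda>a. of_real (S a))"
    by (rule smallo_imp_asymp_equiv)
  then show "(\<lambda>a::nat. W24 a d (of_real (nome a)) - of_nat a ^ 6)
         \<sim>[at_top]
         (\<lambda>a. of_real (48 * pi * (- 1) ^ (d - 1) * 23 ^ (d - 2) * real a powr (- 1 / 2)
                       * exp (- 4 * pi * (real d - 1) * sqrt (real a))))"
    by (simp only: W_def[abs_def] S_def[abs_def])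
qed

end
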